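(* Assume the model conditions (a), (b), (c), (d) stated in the context. Fix $\theta\in\Theta_0$. Let $H$ be an admissible weight, i.e. one satisfying the weight condition (e) of the context, with $\Omega_H(\theta)$ nonsingular, and set $J_H(\theta)=A_H(\theta)^\top\Omega_H(\theta)^{-1}A_H(\theta)$. Then, in the Loewner order, $$J_H(\theta)\preceq I(\theta),\qquad\text{hence}\qquad V_H^{\mathrm{opt}}(\theta):=J_H(\theta)^{-1}\succeq I(\theta)^{-1}$$ whenever both $J_H(\theta)$ and $I(\theta)$ are nonsingular. Equality $J_H(\theta)=I(\theta)$ holds if and only if each row of $H_{\mathrm{score}}$ lies in the closed linear span, under $\langle\cdot,\cdot\rangle_\theta$, of the rows of $H$.
   Context: Setting. $D,p,q\ge 1$ with $q\ge p$ are fixed integers and $A\in(0,\infty)$ is a fixed known memory length. $N=(N_1,\dots,N_D)$ is a simple $D$-variate point process on $\mathbb R$ (no multiple points, also not across components) with natural filtration $\mathcal F_t$; $N(B)=\sum_j N_j(B)$. For a parameter $\theta$ put, for $i=1,\dots,D$, $$\lambda_i(t;\theta)=\phi_{\theta,i}\Big(\nu_{\theta,i}+\sum_{j=1}^D\int_{[t-A,t)}h_{\theta,ij}(t-s)\,dN_j(s)\Big),\qquad h_{\theta,ij}(u)=\tilde h_{\theta,ij}(u)\mathbf 1\{0\le u\le A\},$$ with baselines $\nu_{\theta,i}$, links $\phi_{\theta,i}$, and kernels of either sign; the argument of $\phi_{\theta,i}$ is the linear predictor. $\lambda=(\lambda_1,\dots,\lambda_D)^\top$. $\mathbb P_\theta$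 (expectation $\mathbb E_\theta$) is the law of the stationary process whose $\mathcal F_t$-conditional intensity is $\lambda(\cdot;\theta)$. $\mathfrak C_t=N([t-A,t))$; $G_tN$ is $N|_{[t-A,t)}$ recentred on $[-A,0)$. $D_\theta(t;\theta)=\partial_\theta\lambda(t;\theta)\in\mathbb R^{D\times p}$, $\Lambda(t;\theta)=\mathrm{diag}\{\lambda_1(t;\theta),\dots,\lambda_D(t;\theta)\}$. Model conditions. (a) $\Theta\subset\mathbb R^p$ is compact, $\Theta_0$ is a compact subset of the interior $\Theta^\circ$, and $\Theta$ is contained in a compact convex set $K_\Theta$ lying in the interior of the natural parameter domain. Let $\mathcal X_i(K_\Theta)$ be the set of linear-predictor values attainable with $\theta\in K_\Theta$. The maps $\theta\mapsto\nu_{\theta,i}$ and $(\theta,x)\mapsto\phi_{\theta,i}(x)$ are $C^3$ on neighborhoods of $K_\Theta$ and $K_\Theta\times\mathcal X_i(K_\Theta)$. Uniformly in $i$ on this set, $\phi_{\theta,i}$ is bounded away from zero (positive), $\partial_x\phi_{\theta,i}$ is bounded, and all mixed $(\theta,x)$-derivatives of $\phi_{\theta,i}$ up to order three have at most polynomial growth in $x$. Derivatives of $\nu_{\theta,i}$ up to order three are uniformly bounded on $K_\Theta$. Structural-zero coordinates have been removed from $\theta$. (b) Each $\tilde h_{\theta,ij}$ and its parameter derivatives up to order three are uniformly bounded and continuous on $[0,A]\times K_\Theta$, with second derivatives uniformly Lipschitz in $\theta$. (c) With $L_{\theta,i}$ a Lipschitz constant of $\phi_{\theta,i}$ and $G^{\mathrm{abs}}(\theta)_{ij}=L_{\theta,i}\int_0^A|h_{\theta,ij}(u)|\,du$,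 there is $\varepsilon>0$ with $\sup_{\theta\in\Theta}\rho\{G^{\mathrm{abs}}(\theta)\}\le 1-\varepsilon$ ($\rho$ = spectral radius). (d) For all $\theta,\theta'\in\Theta$, if $\lambda_i(t;\theta)=\lambda_i(t;\theta')$ for every $i$ and Lebesgue-a.e. $t$, $\mathbb P_\theta$-a.s., then $\theta=\theta'$; and the per-time Fisher information $I(\theta)=\mathbb E_\theta\big[\sum_{i=1}^D\lambda_i(0;\theta)^{-1}\nabla_\theta\lambda_i(0;\theta)\nabla_\theta\lambda_i(0;\theta)^\top\big]$ is well defined and uniformly nonsingular on $\Theta_0$. Weights. A weight is a predictable $H(t;\theta)\in\mathbb R^{q\times D}$; $A_H(\theta)=\mathbb E_\theta\{H(0;\theta)D_\theta(0;\theta)\}$, $\Omega_H(\theta)=\mathbb E_\theta\{H(0;\theta)\Lambda(0;\theta)H(0;\theta)^\top\}$. The score weight is $H_{\mathrm{score}}(t;\theta)=D_\theta(t;\theta)^\top\Lambda(t;\theta)^{-1}$. (e) For $r=0,1,2$ there are measurable maps $\mathsf H^{(r)}_\theta$ on local configurations on $[-A,0)$, continuous in $\theta$, with $\nabla_\theta^rH(t;\theta)=\mathsf H^{(r)}_\theta(G_tN)$, and constants $B_r,B_r'<\infty$, $m_r,m_r'\ge0$ such that, for all $t$ and $\theta,\theta'\in K_\Theta$, $\|\nabla_\theta^rH(t;\theta)\|_{\mathrm{op}}\le B_r\{1+\mathfrak C_t^{m_r}\}$ and $\|\nabla_\theta^rH(t;\theta)-\nabla_\theta^rH(t;\theta')\|_{\mathrm{op}}\le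 B_r'\{1+\mathfrak C_t^{m_r'}\}\|\theta-\theta'\|_2$. Inner product. For predictable shift-covariant row-vector ($1\times D$) processes $f,g$, $\langle f,g\rangle_\theta=\mathbb E_\theta\{f(0)\Lambda(0;\theta)g(0)^\top\}$; elements with zero norm difference are identified. The span is over real linear combinations of the $q$ rows of $H(\cdot;\theta)$. *)

theory Defs
  imports "HOL-Probability.Probability"
begin

section \<open>Configurations, filtration, predictability\<close>

text \<open>
  A realisation of a simple \<open>D\<close>-variate point process is the family of its point sets, indexed by
  the components. Simplicity within a component is built into the use of sets; across components it
  is the disjointness clause. All laws live on this canonical space.
\<close>

type_synonym 'd config = "'d \<Rightarrow> real set"

definition configs :: "'d config set" where
  "configs = {\<eta>. (\<forall>j a b. finite (\<eta> j \<inter> {a..b})) \<and> (\<forall>i j. i \<noteq> j \<longrightarrow> \<eta> i \<inter> \<eta> j = {})}"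

definition count_algebra :: "real set \<Rightarrow> 'd config measure" where
  "count_algebra S = sigma configs
     {{\<eta> \<in> configs. card (\<eta> j \<inter> B) = n} | j B n. B \<in> sets borel \<and> bounded B \<and> B \<subseteq> S}"

abbreviation config_space :: "'d config measure" where
  "config_space \<equiv> count_algebra UNIV"

definition history :: "real \<Rightarrow> 'd config measure" where
  "history t = count_algebra {..t}"

definition predictable_space :: "(real \<times> 'd config) measure" where
  "predictable_space = sigma (UNIV \<times> configs) {{s<..u} \<times> E | s u E. E \<in> sets (history s)}"

definition shift :: "real \<Rightarrow> 'd config \<Rightarrow> 'd config" where
  "shift t \<eta> = (\<lambda>j. (\<lambda>s. s - t) ` \<eta> j)"

definition recent :: "real \<Rightarrow> real \<Rightarrow> 'd config \<Rightarrow> 'd config" where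
  "recent A t \<eta> = shift t (\<lambda>j. \<eta> j \<inter> {t - A..<t})"

definition recent_count :: "real \<Rightarrow> real \<Rightarrow> ('d::finite) config \<Rightarrow> nat" where
  "recent_count A t \<eta> = (\<Sum>j\<in>UNIV. card (\<eta> j \<inter> {t - A..<t}))"

definition local_configs :: "real \<Rightarrow> 'd config set" where
  "local_configs A = {\<xi> \<in> configs. \<forall>j. \<xi> j \<subseteq> {-A..<0}}"

definition local_space :: "real \<Rightarrow> 'd config measure" where
  "local_space A = restrict_space config_space (local_configs A)"


section \<open>Derivatives of higher order\<close>

primrec partials :: "'a::euclidean_space list \<Rightarrow> ('a \<Rightarrow> real) \<Rightarrow> 'a \<Rightarrow> real" where
  "partials [] f = f"
| "partials (b # bs) f = (\<lambda>x. frechet_derivative (partials bs f) (at x) b)"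

definition times_differentiable_on :: "nat \<Rightarrow> ('a::euclidean_space \<Rightarrow> real) \<Rightarrow> 'a set \<Rightarrow> bool" where
  "times_differentiable_on k f U \<longleftrightarrow>
     (\<forall>bs. set bs \<subseteq> Basis \<and> length bs < k \<longrightarrow> (\<forall>x\<in>U. partials bs f differentiable (at x)))"

definition C_k_on :: "nat \<Rightarrow> ('a::euclidean_space \<Rightarrow> real) \<Rightarrow> 'a set \<Rightarrow> bool" where
  "C_k_on k f U \<longleftrightarrow> times_differentiable_on k f U \<and>
     (\<forall>bs. set bs \<subseteq> Basis \<and> length bs \<le> k \<longrightarrow> continuous_on U (partials bs f))"


section \<open>Matrices\<close>

definition outer_prod :: "real ^ 'm \<Rightarrow> real ^ 'n \<Rightarrow> real ^ 'n ^ 'm" where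
  "outer_prod v w = (\<chi> a b. v $ a * w $ b)"

definition diag_mat :: "real ^ 'n \<Rightarrow> real ^ 'n ^ 'n" where
  "diag_mat v = (\<chi> i j. if i = j then v $ i else 0)"

definition psd :: "real ^ 'n ^ 'n \<Rightarrow> bool" where
  "psd M \<longleftrightarrow> transpose M = M \<and> (\<forall>v. 0 \<le> v \<bullet> (M *v v))"

definition loewner_le :: "real ^ 'n ^ 'n \<Rightarrow> real ^ 'n ^ 'n \<Rightarrow> bool" where
  "loewner_le M M' \<longleftrightarrow> psd (M' - M)"

definition spec_radius :: "real ^ 'n ^ 'n \<Rightarrow> real" where
  "spec_radius M = Sup {cmod z | z :: complex.
     \<exists>v :: complex ^ 'n. v \<noteq> 0 \<and> (\<chi> i j. complex_of_real (M $ i $ j)) *v v = z *s v}"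


section \<open>The Hawkes model\<close>

text \<open>The functions are total; they are only ever constrained on the parameter sets below.\<close>

record ('d, 'p::finite) hawkes =
  mem_len :: real
  baseline :: "real ^ 'p \<Rightarrow> 'd \<Rightarrow> real"
  link :: "real ^ 'p \<Rightarrow> 'd \<Rightarrow> real \<Rightarrow> real"
  kern :: "real ^ 'p \<Rightarrow> 'd \<Rightarrow> 'd \<Rightarrow> real \<Rightarrow> real"

definition trunc_kern :: "('d, 'p::finite) hawkes \<Rightarrow> real ^ 'p \<Rightarrow> 'd \<Rightarrow> 'd \<Rightarrow> real \<Rightarrow> real" where
  "trunc_kern M \<theta> i j u = (if 0 \<le> u \<and> u \<le> mem_len M then kern M \<theta> i j u else 0)"

definition linpred ::
  "('d::finite, 'p::finite) hawkes \<Rightarrow> real \<Rightarrow> real ^ 'p \<Rightarrow> 'd config \<Rightarrow> 'd \<Rightarrow> real" where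
  "linpred M t \<theta> \<eta> i =
     baseline M \<theta> i + (\<Sum>j\<in>UNIV. \<Sum>s\<in>\<eta> j \<inter> {t - mem_len M..<t}. trunc_kern M \<theta> i j (t - s))"

definition intensity ::
  "('d::finite, 'p::finite) hawkes \<Rightarrow> real \<Rightarrow> real ^ 'p \<Rightarrow> 'd config \<Rightarrow> real ^ 'd" where
  "intensity M t \<theta> \<eta> = (\<chi> i. link M \<theta> i (linpred M t \<theta> \<eta> i))"

definition intensity_deriv ::
  "('d::finite, 'p::finite) hawkes \<Rightarrow> real \<Rightarrow> real ^ 'p \<Rightarrow> 'd config \<Rightarrow> real ^ 'p ^ 'd" where
  "intensity_deriv M t \<theta> \<eta> = jacobian (\<lambda>\<theta>'. intensity M t \<theta>' \<eta>) (at \<theta>)"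

definition intensity_diag ::
  "('d::finite, 'p::finite) hawkes \<Rightarrow> real \<Rightarrow> real ^ 'p \<Rightarrow> 'd config \<Rightarrow> real ^ 'd ^ 'd" where
  "intensity_diag M t \<theta> \<eta> = diag_mat (intensity M t \<theta> \<eta>)"

definition attainable ::
  "('d::finite, 'p::finite) hawkes \<Rightarrow> (real ^ 'p) set \<Rightarrow> 'd \<Rightarrow> real set" where
  "attainable M K i = {linpred M t \<theta> \<eta> i | t \<theta> \<eta>. \<theta> \<in> K \<and> \<eta> \<in> configs}"

text \<open>
  The conditional intensity with respect to the natural filtration is expressed by
  \<open>E \<integral> C dN\<^sub>i = E \<integral> C \<lambda>\<^sub>i dt\<close> for all nonnegative predictable \<open>C\<close>. No moment of the process is
  assumed to be finite.
\<close>

definition stationary_law ::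
  "('d::finite, 'p::finite) hawkes \<Rightarrow> real ^ 'p \<Rightarrow> 'd config measure \<Rightarrow> bool" where
  "stationary_law M \<theta> P \<longleftrightarrow>
     prob_space P \<and> space P = configs \<and> sets P = sets config_space \<and>
     (\<forall>t. distr P config_space (shift t) = P) \<and>
     (\<forall>i. \<forall>C \<in> borel_measurable predictable_space.
        (\<integral>\<^sup>+\<eta>. (\<integral>\<^sup>+s. C (s, \<eta>) \<partial>count_space (\<eta> i)) \<partial>P) =
        (\<integral>\<^sup>+\<eta>. (\<integral>\<^sup>+s. C (s, \<eta>) * ennreal (intensity M s \<theta> \<eta> $ i) \<partial>lborel) \<partial>P))"

definition fisher_integrand ::
  "('d::finite, 'p::finite) hawkes \<Rightarrow> real ^ 'p \<Rightarrow> 'd config \<Rightarrow> real ^ 'p ^ 'p" where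
  "fisher_integrand M \<theta> \<eta> =
     (\<Sum>i\<in>UNIV. inverse (intensity M 0 \<theta> \<eta> $ i) *\<^sub>R
        outer_prod (row i (intensity_deriv M 0 \<theta> \<eta>)) (row i (intensity_deriv M 0 \<theta> \<eta>)))"

definition fisher ::
  "('d::finite, 'p::finite) hawkes \<Rightarrow> (real ^ 'p \<Rightarrow> 'd config measure) \<Rightarrow> real ^ 'p \<Rightarrow> real ^ 'p ^ 'p" where
  "fisher M P \<theta> = (\<integral>\<eta>. fisher_integrand M \<theta> \<eta> \<partial>P \<theta>)"


section \<open>Model conditions\<close>

definition condition_a ::
  "('d::finite, 'p::finite) hawkes \<Rightarrow>
   (real ^ 'p) set \<Rightarrow> (real ^ 'p) set \<Rightarrow> (real ^ 'p) set \<Rightarrow> (real ^ 'p) set \<Rightarrow> bool" where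
  "condition_a M Dom K \<Theta> \<Theta>0 \<longleftrightarrow>
     compact \<Theta> \<and> compact \<Theta>0 \<and> \<Theta>0 \<subseteq> interior \<Theta> \<and>
     compact K \<and> convex K \<and> \<Theta> \<subseteq> K \<and> K \<subseteq> interior Dom \<and>
     (\<forall>i. \<exists>V. open V \<and> K \<subseteq> V \<and> V \<subseteq> Dom \<and> C_k_on 3 (\<lambda>\<theta>. baseline M \<theta> i) V) \<and>
     (\<forall>i. \<exists>U. open U \<and> K \<times> attainable M K i \<subseteq> U \<and> U \<subseteq> Dom \<times> UNIV \<and>
        C_k_on 3 (\<lambda>(\<theta>, x). link M \<theta> i x) U) \<and>
     (\<exists>c>0. \<forall>i. \<forall>\<theta>\<in>K. \<forall>x\<in>attainable M K i. c \<le> link M \<theta> i x) \<and>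
     (\<exists>B. \<forall>i. \<forall>\<theta>\<in>K. \<forall>x\<in>attainable M K i. \<bar>deriv (link M \<theta> i) x\<bar> \<le> B) \<and>
     (\<exists>B. \<exists>m::nat. \<forall>i. \<forall>\<theta>\<in>K. \<forall>x\<in>attainable M K i. \<forall>bs. set bs \<subseteq> Basis \<and> length bs \<le> 3 \<longrightarrow>
        \<bar>partials bs (\<lambda>(\<theta>, x). link M \<theta> i x) (\<theta>, x)\<bar> \<le> B * (1 + \<bar>x\<bar> ^ m)) \<and>
     (\<exists>B. \<forall>i. \<forall>\<theta>\<in>K. \<forall>bs. set bs \<subseteq> Basis \<and> length bs \<le> 3 \<longrightarrow>
        \<bar>partials bs (\<lambda>\<theta>. baseline M \<theta> i) \<theta>\<bar> \<le> B)"

definition condition_b ::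
  "('d::finite, 'p::finite) hawkes \<Rightarrow> (real ^ 'p) set \<Rightarrow> (real ^ 'p) set \<Rightarrow> bool" where
  "condition_b M Dom K \<longleftrightarrow>
     (\<forall>i j. \<exists>V. open V \<and> K \<subseteq> V \<and> V \<subseteq> Dom \<and>
        (\<forall>u\<in>{0..mem_len M}. times_differentiable_on 3 (\<lambda>\<theta>. kern M \<theta> i j u) V)) \<and>
     (\<forall>i j. \<forall>bs. set bs \<subseteq> Basis \<and> length bs \<le> 3 \<longrightarrow>
        continuous_on ({0..mem_len M} \<times> K) (\<lambda>(u, \<theta>). partials bs (\<lambda>\<theta>. kern M \<theta> i j u) \<theta>)) \<and>
     (\<exists>B. \<forall>i j. \<forall>u\<in>{0..mem_len M}. \<forall>\<theta>\<in>K. \<forall>bs. set bs \<subseteq> Basis \<and> length bs \<le> 3 \<longrightarrow>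
        \<bar>partials bs (\<lambda>\<theta>. kern M \<theta> i j u) \<theta>\<bar> \<le> B) \<and>
     (\<exists>L. \<forall>i j. \<forall>u\<in>{0..mem_len M}. \<forall>bs. set bs \<subseteq> Basis \<and> length bs = 2 \<longrightarrow>
        L-lipschitz_on K (partials bs (\<lambda>\<theta>. kern M \<theta> i j u)))"

definition G_abs ::
  "('d::finite, 'p::finite) hawkes \<Rightarrow> (real ^ 'p \<Rightarrow> 'd \<Rightarrow> real) \<Rightarrow> real ^ 'p \<Rightarrow> real ^ 'd ^ 'd" where
  "G_abs M lip \<theta> =
     (\<chi> i j. lip \<theta> i * (LINT u:{0..mem_len M}|lborel. \<bar>trunc_kern M \<theta> i j u\<bar>))"

text \<open>The Lipschitz constants refer to the linear-predictor values attainable over \<open>K\<close>, the set on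
  which the links are specified.\<close>

definition condition_c ::
  "('d::finite, 'p::finite) hawkes \<Rightarrow> (real ^ 'p \<Rightarrow> 'd \<Rightarrow> real) \<Rightarrow>
   (real ^ 'p) set \<Rightarrow> (real ^ 'p) set \<Rightarrow> bool" where
  "condition_c M lip K \<Theta> \<longleftrightarrow>
     (\<forall>\<theta>\<in>\<Theta>. \<forall>i. (lip \<theta> i)-lipschitz_on (attainable M K i) (link M \<theta> i)) \<and>
     (\<exists>\<epsilon>>0. \<forall>\<theta>\<in>\<Theta>. spec_radius (G_abs M lip \<theta>) \<le> 1 - \<epsilon>)"

text \<open>Uniform nonsingularity: inverses exist and are uniformly bounded.\<close>

definition condition_d ::
  "('d::finite, 'p::finite) hawkes \<Rightarrow> (real ^ 'p \<Rightarrow> 'd config measure) \<Rightarrow>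
   (real ^ 'p) set \<Rightarrow> (real ^ 'p) set \<Rightarrow> bool" where
  "condition_d M P \<Theta> \<Theta>0 \<longleftrightarrow>
     (\<forall>\<theta>\<in>\<Theta>. \<forall>\<theta>'\<in>\<Theta>.
        (AE \<eta> in P \<theta>. AE t in lborel. \<forall>i. intensity M t \<theta> \<eta> $ i = intensity M t \<theta>' \<eta> $ i)
        \<longrightarrow> \<theta> = \<theta>') \<and>
     (\<forall>\<theta>\<in>\<Theta>0. integrable (P \<theta>) (fisher_integrand M \<theta>)) \<and>
     (\<forall>\<theta>\<in>\<Theta>0. invertible (fisher M P \<theta>)) \<and>
     (\<exists>B. \<forall>\<theta>\<in>\<Theta>0. onorm (\<lambda>v. matrix_inv (fisher M P \<theta>) *v v) \<le> B)"


section \<open>Weights\<close>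

text \<open>
  A weight is a map \<open>H t \<theta> \<eta>\<close> with values in the \<open>q \<times> D\<close> matrices. Its \<open>\<theta>\<close>-derivatives of order
  \<open>r\<close> are \<open>r\<close>-linear maps into the operators \<open>\<real>\<^sup>D \<rightarrow> \<real>\<^sup>q\<close>; with the type of bounded linear
  functions, \<open>norm\<close> is the operator norm at every order. Derivatives are taken within the
  parameter set \<open>K\<close>.
\<close>

type_synonym ('d, 'p, 'q) weight = "real \<Rightarrow> real ^ 'p \<Rightarrow> 'd config \<Rightarrow> real ^ 'd ^ 'q"

definition mat_op :: "real ^ 'd ^ 'q \<Rightarrow> (real ^ 'd) \<Rightarrow>\<^sub>L (real ^ 'q)" where
  "mat_op X = Blinfun (\<lambda>v. X *v v)"

definition admissible_local_map ::
  "real \<Rightarrow> (real ^ 'p) set \<Rightarrow>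
   (real ^ 'p \<Rightarrow> ('d::finite) config \<Rightarrow> 'b::real_normed_vector) \<Rightarrow> bool" where
  "admissible_local_map A K F \<longleftrightarrow>
     (\<forall>\<theta>\<in>K. F \<theta> \<in> borel_measurable (local_space A)) \<and>
     (\<forall>\<xi>\<in>local_configs A. continuous_on K (\<lambda>\<theta>. F \<theta> \<xi>)) \<and>
     (\<exists>B. \<exists>m\<ge>0. \<forall>t. \<forall>\<theta>\<in>K. \<forall>\<eta>\<in>configs.
        norm (F \<theta> (recent A t \<eta>)) \<le> B * (1 + real (recent_count A t \<eta>) powr m)) \<and>
     (\<exists>B. \<exists>m\<ge>0. \<forall>t. \<forall>\<theta>\<in>K. \<forall>\<theta>'\<in>K. \<forall>\<eta>\<in>configs.
        norm (F \<theta> (recent A t \<eta>) - F \<theta>' (recent A t \<eta>))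
          \<le> B * (1 + real (recent_count A t \<eta>) powr m) * norm (\<theta> - \<theta>'))"

definition admissible_weight ::
  "real \<Rightarrow> (real ^ 'p) set \<Rightarrow> ('d::finite, 'p::finite, 'q::finite) weight \<Rightarrow> bool" where
  "admissible_weight A K H \<longleftrightarrow>
     (\<forall>\<theta>\<in>K. (\<lambda>(t, \<eta>). H t \<theta> \<eta>) \<in> borel_measurable predictable_space) \<and>
     (\<exists>H0 H1 H2.
        admissible_local_map A K H0 \<and> admissible_local_map A K H1 \<and> admissible_local_map A K H2 \<and>
        (\<forall>t. \<forall>\<theta>\<in>K. \<forall>\<eta>\<in>configs.
           mat_op (H t \<theta> \<eta>) = H0 \<theta> (recent A t \<eta>) \<and>
           ((\<lambda>\<theta>'. mat_op (H t \<theta>' \<eta>)) has_derivative blinfun_apply (H1 \<theta> (recent A t \<eta>)))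
             (at \<theta> within K) \<and>
           ((\<lambda>\<theta>'. H1 \<theta>' (recent A t \<eta>)) has_derivative blinfun_apply (H2 \<theta> (recent A t \<eta>)))
             (at \<theta> within K)))"

definition A_mat ::
  "('d::finite, 'p::finite) hawkes \<Rightarrow> (real ^ 'p \<Rightarrow> 'd config measure) \<Rightarrow>
   ('d, 'p, 'q::finite) weight \<Rightarrow> real ^ 'p \<Rightarrow> real ^ 'p ^ 'q" where
  "A_mat M P H \<theta> = (\<integral>\<eta>. H 0 \<theta> \<eta> ** intensity_deriv M 0 \<theta> \<eta> \<partial>P \<theta>)"

definition Omega_mat ::
  "('d::finite, 'p::finite) hawkes \<Rightarrow> (real ^ 'p \<Rightarrow> 'd config measure) \<Rightarrow>
   ('d, 'p, 'q::finite) weight \<Rightarrow> real ^ 'p \<Rightarrow> real ^ 'q ^ 'q" where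
  "Omega_mat M P H \<theta> =
     (\<integral>\<eta>. H 0 \<theta> \<eta> ** intensity_diag M 0 \<theta> \<eta> ** transpose (H 0 \<theta> \<eta>) \<partial>P \<theta>)"

definition J_mat ::
  "('d::finite, 'p::finite) hawkes \<Rightarrow> (real ^ 'p \<Rightarrow> 'd config measure) \<Rightarrow>
   ('d, 'p, 'q::finite) weight \<Rightarrow> real ^ 'p \<Rightarrow> real ^ 'p ^ 'p" where
  "J_mat M P H \<theta> =
     transpose (A_mat M P H \<theta>) ** matrix_inv (Omega_mat M P H \<theta>) ** A_mat M P H \<theta>"

definition V_opt ::
  "('d::finite, 'p::finite) hawkes \<Rightarrow> (real ^ 'p \<Rightarrow> 'd config measure) \<Rightarrow>
   ('d, 'p, 'q::finite) weight \<Rightarrow> real ^ 'p \<Rightarrow> real ^ 'p ^ 'p" where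
  "V_opt M P H \<theta> = matrix_inv (J_mat M P H \<theta>)"

definition score_weight :: "('d::finite, 'p::finite) hawkes \<Rightarrow> ('d, 'p, 'p) weight" where
  "score_weight M t \<theta> \<eta> =
     transpose (intensity_deriv M t \<theta> \<eta>) ** matrix_inv (intensity_diag M t \<theta> \<eta>)"


section \<open>Row processes and closed linear spans\<close>

type_synonym 'd row_process = "real \<Rightarrow> 'd config \<Rightarrow> real ^ 'd"

definition row_integrand ::
  "('d::finite, 'p::finite) hawkes \<Rightarrow> real ^ 'p \<Rightarrow> 'd row_process \<Rightarrow> 'd row_process \<Rightarrow>
   'd config \<Rightarrow> real" where
  "row_integrand M \<theta> f g \<eta> = f 0 \<eta> \<bullet> (intensity_diag M 0 \<theta> \<eta> *v g 0 \<eta>)"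

definition row_inner ::
  "('d::finite, 'p::finite) hawkes \<Rightarrow> (real ^ 'p \<Rightarrow> 'd config measure) \<Rightarrow> real ^ 'p \<Rightarrow>
   'd row_process \<Rightarrow> 'd row_process \<Rightarrow> real" where
  "row_inner M P \<theta> f g = (\<integral>\<eta>. row_integrand M \<theta> f g \<eta> \<partial>P \<theta>)"

definition row_norm ::
  "('d::finite, 'p::finite) hawkes \<Rightarrow> (real ^ 'p \<Rightarrow> 'd config measure) \<Rightarrow> real ^ 'p \<Rightarrow>
   'd row_process \<Rightarrow> real" where
  "row_norm M P \<theta> f = sqrt (row_inner M P \<theta> f f)"

definition row_space ::
  "('d::finite, 'p::finite) hawkes \<Rightarrow> (real ^ 'p \<Rightarrow> 'd config measure) \<Rightarrow> real ^ 'p \<Rightarrow>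
   'd row_process set" where
  "row_space M P \<theta> = {f.
     (\<lambda>(t, \<eta>). f t \<eta>) \<in> borel_measurable predictable_space \<and>
     (\<forall>t. \<forall>\<eta>\<in>configs. f t \<eta> = f 0 (shift t \<eta>)) \<and>
     integrable (P \<theta>) (row_integrand M \<theta> f f)}"

definition weight_row ::
  "('d::finite, 'p::finite, 'q::finite) weight \<Rightarrow> real ^ 'p \<Rightarrow> 'q \<Rightarrow> 'd row_process" where
  "weight_row H \<theta> k = (\<lambda>t \<eta>. row k (H t \<theta> \<eta>))"

text \<open>
  Closure in the seminorm. Processes at seminorm distance zero are not distinguished by membership,
  so no quotient is formed. The requirement that the combination lies in \<open>row_space\<close> keeps the
  Bochner integral in \<open>row_norm\<close> from being the default value of a non-integrable function.
\<close>

definition closed_row_span ::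
  "('d::finite, 'p::finite) hawkes \<Rightarrow> (real ^ 'p \<Rightarrow> 'd config measure) \<Rightarrow> real ^ 'p \<Rightarrow>
   ('d, 'p, 'q::finite) weight \<Rightarrow> 'd row_process set" where
  "closed_row_span M P \<theta> H = {f \<in> row_space M P \<theta>.
     \<forall>e>0. \<exists>c :: 'q \<Rightarrow> real.
       (\<lambda>t \<eta>. \<Sum>k\<in>UNIV. c k *\<^sub>R weight_row H \<theta> k t \<eta>) \<in> row_space M P \<theta> \<and>
       row_norm M P \<theta> (\<lambda>t \<eta>. f t \<eta> - (\<Sum>k\<in>UNIV. c k *\<^sub>R weight_row H \<theta> k t \<eta>)) < e}"

end

theory Submission
  imports Defs
begin

text \<open>
  The form \<open>\<langle>f, g\<rangle> = E f \<Lambda> g\<^sup>T\<close> is a semi-inner product on row processes. The score rows are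
  \<open>s\<^sub>a = (D\<^sub>1\<^sub>a / \<lambda>\<^sub>1, \<dots>, D\<^sub>d\<^sub>a / \<lambda>\<^sub>d)\<close>, so the factor \<open>\<Lambda>\<close> cancels one division and three matrices
  become Gram matrices: \<open>I\<close> of the score rows (\<open>fisher_gram\<close>), \<open>\<Omega>\<close> of the rows \<open>h\<^sub>k\<close> of \<open>H\<close>
  (\<open>Omega_gram\<close>), and \<open>A\<close> of the rows of \<open>H\<close> against the score rows (\<open>A_gram\<close>). Hence
  \<open>\<parallel>\<Sum> v\<^sub>a s\<^sub>a - \<Sum> c\<^sub>k h\<^sub>k\<parallel>\<^sup>2 = v \<bullet> I v - 2 c \<bullet> A v + c \<bullet> \<Omega> c\<close> (\<open>squared_distance\<close>). Completing the square in
  \<open>c\<close> (\<open>complete_square\<close>) shows that the least value is \<open>v \<bullet> (I - J) v\<close>, attained at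
  \<open>c = \<Omega>\<^sup>-\<^sup>1 A v\<close>: the Schur complement \<open>I - J\<close> is the Gram matrix of the residuals of the score rows
  after projection on the rows of \<open>H\<close>.

  This yields every claim. A squared norm is nonnegative, so \<open>J \<preceq> I\<close>, and inversion reverses the
  order (\<open>loewner_le_matrix_inv\<close>). A diagonal entry of \<open>I - J\<close> is the squared distance of a score
  row from the span of the rows of \<open>H\<close>, so it vanishes exactly when that row lies in the closed
  span; and a positive semidefinite matrix with zero diagonal is zero.

  The analytic work is to show that the score rows are legitimate elements of the space. The linear
  predictor is adapted and left-continuous in time, hence predictable
  (\<open>left_continuous_adapted_predictable\<close>); the intensities inherit this, and so do their parameter
  derivatives as limits of difference quotients. Integrability of the mixed products follows from
  that of \<open>\<Omega>\<close> and \<open>I\<close>.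
\<close>


section \<open>Schur complements in the Loewner order\<close>

lemma matrix_inv_mult:
  fixes S :: "real ^ 'n ^ 'n"
  assumes "invertible S"
  shows "S ** matrix_inv S = mat 1" "matrix_inv S ** S = mat 1"
proof -
  from assms obtain T where "S ** T = mat 1 \<and> T ** S = mat 1"
    by (auto simp: invertible_def)
  then have "S ** matrix_inv S = mat 1 \<and> matrix_inv S ** S = mat 1"
    unfolding matrix_inv_def by (rule someI)
  then show "S ** matrix_inv S = mat 1" "matrix_inv S ** S = mat 1"
    by auto
qed

lemma transpose_matrix_inv:
  fixes S :: "real ^ 'n ^ 'n"
  assumes "invertible S" "transpose S = S"
  shows "transpose (matrix_inv S) = matrix_inv S"
proof -
  have "transpose (matrix_inv S) ** S = mat 1"
    using arg_cong[OF matrix_inv_mult(1)[OF assms(1)], of transpose] assms(2)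
    by (simp add: matrix_transpose_mul)
  then have "transpose (matrix_inv S) ** (S ** matrix_inv S) = matrix_inv S"
    by (simp add: matrix_mul_assoc)
  then show ?thesis
    by (simp add: matrix_inv_mult[OF assms(1)])
qed

lemma inner_symmetric_matrix:
  fixes S :: "real ^ 'n ^ 'n"
  assumes "transpose S = S"
  shows "x \<bullet> (S *v y) = y \<bullet> (S *v x)"
  using dot_lmul_matrix[of x S y] transpose_matrix_vector[of S x] assms
  by (simp add: inner_commute)

lemma matrix_inv_vector:
  fixes S :: "real ^ 'n ^ 'n"
  assumes "invertible S"
  shows "S *v (matrix_inv S *v x) = x"
  by (simp add: matrix_vector_mul_assoc matrix_inv_mult[OF assms])

text \<open>
  With \<open>x = I\<^sup>-\<^sup>1 v\<close> and \<open>y = J\<^sup>-\<^sup>1 v\<close>, the claim is the inequality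
  \<open>0 \<le> (x - y) \<bullet> J (x - y)\<close> after replacing \<open>x \<bullet> J x\<close> by the larger \<open>x \<bullet> I x\<close>.
\<close>

lemma loewner_le_matrix_inv:
  fixes J I :: "real ^ 'n ^ 'n"
  assumes J: "psd J" "invertible J" and I: "transpose I = I" "invertible I"
    and le: "loewner_le J I"
  shows "loewner_le (matrix_inv I) (matrix_inv J)"
proof -
  have symJ: "transpose J = J"
    using J(1) by (simp add: psd_def)
  have "0 \<le> v \<bullet> ((matrix_inv J - matrix_inv I) *v v)" for v
  proof -
    define x where "x = matrix_inv I *v v"
    define y where "y = matrix_inv J *v v"
    have Ix: "I *v x = v" and Jy: "J *v y = v"
      by (simp_all add: x_def y_def matrix_inv_vector I(2) J(2))
    have "0 \<le> (x - y) \<bullet> (J *v (x - y))"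
      using J(1) by (simp add: psd_def)
    also have "\<dots> = x \<bullet> (J *v x) - 2 * (x \<bullet> v) + v \<bullet> y"
      using inner_symmetric_matrix[OF symJ, of x y]
      by (simp add: matrix_vector_mult_diff_distrib inner_diff_left inner_diff_right Jy inner_commute)
    also have "\<dots> \<le> x \<bullet> (I *v x) - 2 * (x \<bullet> v) + v \<bullet> y"
      using le by (simp add: loewner_le_def psd_def matrix_vector_mult_diff_rdistrib inner_diff_right)
    also have "\<dots> = v \<bullet> ((matrix_inv J - matrix_inv I) *v v)"
      by (simp add: Ix matrix_vector_mult_diff_rdistrib inner_diff_right x_def[symmetric]
          y_def[symmetric] inner_commute)
    finally show ?thesis .
  qed
  moreover have "transpose (matrix_inv J - matrix_inv I) = matrix_inv J - matrix_inv I"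
    using transpose_matrix_inv[OF J(2) symJ] transpose_matrix_inv[OF I(2,1)]
    by (simp add: transpose_def vec_eq_iff)
  ultimately show ?thesis
    by (simp add: loewner_le_def psd_def)
qed

lemma psd_zero_diagonal:
  fixes S :: "real ^ 'n ^ 'n"
  assumes S: "psd S" and diag: "\<And>a. S $ a $ a = 0"
  shows "S = 0"
proof -
  have entry: "axis a 1 \<bullet> (S *v axis b 1) = S $ a $ b" for a b
    by (simp add: inner_axis' matrix_vector_mul_component inner_axis)
  have sym: "transpose S = S"
    using S by (simp add: psd_def)
  have "S $ a $ b = 0" for a b
  proof -
    \<comment> \<open>On \<open>e\<^sub>a + t e\<^sub>b\<close> the quadratic form is linear in \<open>t\<close>, so both signs of \<open>t\<close> bound it.\<close>
    have "0 \<le> (axis a 1 + t *\<^sub>R axis b 1) \<bullet> (S *v (axis a 1 + t *\<^sub>R axis b 1))" for t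
      using S by (simp add: psd_def)
    also have "\<dots> t = 2 * t * S $ a $ b" for t
      using inner_symmetric_matrix[OF sym, of "axis b 1" "axis a 1"]
      by (simp add: matrix_vector_right_distrib scaleR_matrix_vector_assoc[symmetric]
          matrix_vector_mult_scaleR inner_add_left inner_add_right entry diag)
    finally have "0 \<le> 2 * t * S $ a $ b" for t .
    from this[of 1] this[of "-1"] show ?thesis by simp
  qed
  then show ?thesis by (simp add: vec_eq_iff)
qed

text \<open>
  The quadratic polynomial \<open>v \<bullet> I v - 2 c \<bullet> A v + c \<bullet> \<Omega> c\<close> in \<open>c\<close> is the squared distance of a
  vector with coordinates \<open>v\<close> from a linear combination with coefficients \<open>c\<close> whenever \<open>I\<close>, \<open>\<Omega>\<close>
  are the Gram matrices and \<open>A\<close> the cross-Gram matrix. Completing the square gives the minimiser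
  \<open>c = \<Omega>\<^sup>-\<^sup>1 A v\<close>, and the minimum is the quadratic form of the Schur complement.
\<close>

lemma complete_square:
  fixes \<Omega> :: "real ^ 'q ^ 'q" and A :: "real ^ 'p ^ 'q" and I :: "real ^ 'p ^ 'p"
  assumes sym: "transpose \<Omega> = \<Omega>" and inv: "invertible \<Omega>"
  defines "J \<equiv> transpose A ** matrix_inv \<Omega> ** A"
    and "c0 v \<equiv> matrix_inv \<Omega> *v (A *v v)"
  shows "v \<bullet> (I *v v) - 2 * (c \<bullet> (A *v v)) + c \<bullet> (\<Omega> *v c) =
    v \<bullet> ((I - J) *v v) + (c - c0 v) \<bullet> (\<Omega> *v (c - c0 v))"
proof -
  have \<Omega>c0: "\<Omega> *v c0 v = A *v v"
    by (simp add: c0_def matrix_inv_vector inv)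
  have "v \<bullet> (J *v v) = v \<bullet> (transpose A *v c0 v)"
    by (simp add: J_def c0_def matrix_vector_mul_assoc[symmetric] del: transpose_matrix_vector)
  also have "\<dots> = c0 v \<bullet> (A *v v)"
    using dot_lmul_matrix[of "c0 v" A v] by (simp add: inner_commute)
  finally have "v \<bullet> (J *v v) = c0 v \<bullet> (A *v v)" .
  moreover have "c0 v \<bullet> (\<Omega> *v c) = c \<bullet> (A *v v)"
    using inner_symmetric_matrix[OF sym, of "c0 v" c] \<Omega>c0 by simp
  ultimately show ?thesis
    by (simp add: matrix_vector_mult_diff_distrib matrix_vector_mult_diff_rdistrib
        inner_diff_left inner_diff_right \<Omega>c0)
qed

lemma transpose_schur:
  fixes \<Omega> :: "real ^ 'q ^ 'q" and A :: "real ^ 'p ^ 'q"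
  assumes "transpose \<Omega> = \<Omega>" "invertible \<Omega>"
  shows "transpose (transpose A ** matrix_inv \<Omega> ** A) = transpose A ** matrix_inv \<Omega> ** A"
  using transpose_matrix_inv[OF assms(2,1)]
  by (simp add: matrix_transpose_mul matrix_mul_assoc)


section \<open>Predictability of left-continuous adapted processes\<close>

lemma count_algebra_generators:
  "{{\<eta> \<in> configs. card (\<eta> j \<inter> B) = n} | j B n. B \<in> sets borel \<and> bounded B \<and> B \<subseteq> S}
     \<subseteq> Pow configs"
  by auto

lemma space_count_algebra [simp]: "space (count_algebra S) = configs"
  unfolding count_algebra_def by (rule space_measure_of[OF count_algebra_generators])

lemma sets_count_algebra:
  "sets (count_algebra S) = sigma_sets configs
    {{\<eta> \<in> configs. card (\<eta> j \<inter> B) = n} | j B n. B \<in> sets borel \<and> bounded B \<and> B \<subseteq> S}"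
  unfolding count_algebra_def by (rule sets_measure_of[OF count_algebra_generators])

lemma space_history [simp]: "space (history t) = configs"
  by (simp add: history_def)

lemma sets_history_subset: "sets (history t) \<subseteq> sets config_space"
  unfolding history_def sets_count_algebra by (rule sigma_sets_mono') blast

lemma predictable_generators:
  "{{s<..u} \<times> E | s u E. E \<in> sets (history s)} \<subseteq> Pow (UNIV \<times> (configs :: 'd config set))"
  using sets.sets_into_space[of _ "history _ :: 'd config measure"] by fastforce

lemma space_predictable [simp]: "space predictable_space = UNIV \<times> configs"
  unfolding predictable_space_def by (rule space_measure_of[OF predictable_generators])

lemma sets_predictable:
  "sets predictable_space =
    sigma_sets (UNIV \<times> configs) {{s<..u} \<times> E | s u E. E \<in> sets (history s)}"
  unfolding predictable_space_def by (rule sets_measure_of[OF predictable_generators])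

lemma rectangle_predictable: "E \<in> sets (history s) \<Longrightarrow> {s<..u} \<times> E \<in> sets predictable_space"
  unfolding sets_predictable by (rule sigma_sets.Basic) blast

lemma finite_points:
  assumes "\<eta> \<in> configs" "bounded B"
  shows "finite (\<eta> j \<inter> B)"
proof -
  obtain a where "B \<subseteq> {-a..a}"
    using assms(2) by (force simp: bounded_iff abs_le_iff)
  moreover have "finite (\<eta> j \<inter> {-a..a})"
    using assms(1) by (simp add: configs_def)
  ultimately show ?thesis
    by (meson Int_mono finite_subset order_refl)
qed

lemma count_measurable:
  assumes "B \<in> sets borel" "bounded B" "B \<subseteq> S"
  shows "(\<lambda>\<eta>. real (card (\<eta> j \<inter> B))) \<in> borel_measurable (count_algebra S)"
proof -
  have "(\<lambda>\<eta>. card (\<eta> j \<inter> B)) \<in> measurable (count_algebra S) (count_space UNIV)"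
  proof (subst measurable_count_space_eq_countable, safe)
    fix n
    have "{\<eta> \<in> configs. card (\<eta> j \<inter> B) = n} \<in> sets (count_algebra S)"
      unfolding sets_count_algebra using assms by (intro sigma_sets.Basic) blast
    also have "{\<eta> \<in> configs. card (\<eta> j \<inter> B) = n}
        = (\<lambda>\<eta>. card (\<eta> j \<inter> B)) -` {n} \<inter> space (count_algebra S)"
      by auto
    finally show "(\<lambda>\<eta>. card (\<eta> j \<inter> B)) -` {n} \<inter> space (count_algebra S)
        \<in> sets (count_algebra S)" .
  qed auto
  then show ?thesis by simp
qed

text \<open>
  Sums over points extend the counts from indicators to Borel functions. Each sum has finitely many
  terms, because only finitely many points lie in a bounded set, so it commutes with pointwise limits
  of \<open>g\<close>.
\<close>

lemma point_sum_measurable: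
  assumes g: "g \<in> borel_measurable borel" and B: "B \<in> sets borel" "bounded B" "B \<subseteq> S"
  shows "(\<lambda>\<eta>. \<Sum>s\<in>\<eta> j \<inter> B. g s :: real) \<in> borel_measurable (count_algebra S)"
proof -
  have nonneg: "(\<lambda>\<eta>. \<Sum>s\<in>\<eta> j \<inter> B. u s) \<in> borel_measurable (count_algebra S)"
    if "u \<in> borel_measurable borel" "\<And>x. 0 \<le> u x" for u :: "real \<Rightarrow> real"
    using that
  proof (induction rule: borel_measurable_induct_real)
    case (set C)
    have "(\<lambda>\<eta>. real (card (\<eta> j \<inter> (B \<inter> C)))) \<in> borel_measurable (count_algebra S)"
      using B set by (intro count_measurable) (auto intro: bounded_subset)
    also have "?this \<longleftrightarrow> ?case"
    proof (rule measurable_cong)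
      fix \<eta> :: "'a config" assume "\<eta> \<in> space (count_algebra S)"
      then have "finite (\<eta> j \<inter> B)"
        using finite_points B(2) by auto
      then show "real (card (\<eta> j \<inter> (B \<inter> C))) = (\<Sum>s\<in>\<eta> j \<inter> B. indicator C s)"
        by (simp add: sum.If_cases indicator_def Int_assoc Collect_conj_eq)
    qed
    finally show ?case .
  next
    case (mult u c)
    then show ?case by (simp add: sum_distrib_left[symmetric])
  next
    case (add u v)
    then show ?case by (simp add: sum.distrib)
  next
    case (seq U)
    show ?case
      by (rule borel_measurable_LIMSEQ_real[where u = "\<lambda>i \<eta>. \<Sum>s\<in>\<eta> j \<inter> B. U i s"])
        (use seq in \<open>auto intro!: tendsto_sum\<close>)
  qed
  have "(\<lambda>\<eta>. (\<Sum>s\<in>\<eta> j \<inter> B. max 0 (g s)) - (\<Sum>s\<in>\<eta> j \<inter> B. max 0 (- g s)))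
      \<in> borel_measurable (count_algebra S)"
    using g by (intro borel_measurable_diff nonneg) auto
  also have "(\<lambda>\<eta>. (\<Sum>s\<in>\<eta> j \<inter> B. max 0 (g s)) - (\<Sum>s\<in>\<eta> j \<inter> B. max 0 (- g s)))
      = (\<lambda>\<eta>. \<Sum>s\<in>\<eta> j \<inter> B. g s)"
    by (auto simp: sum_subtractf[symmetric] max_def intro!: sum.cong)
  finally show ?thesis .
qed

text \<open>
  Zero outside the strip, so that the superlevel sets are generating rectangles or complements of
  rectangles.
\<close>

lemma predictable_strip:
  assumes Y: "Y \<in> borel_measurable (history s)"
  shows "(\<lambda>(t, \<eta>). if t \<in> {s<..u} then Y \<eta> else (0::real)) \<in> borel_measurable predictable_space"
  unfolding borel_measurable_iff_greater
proof
  fix a :: real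
  have strip: "{s<..u} \<times> {\<eta> \<in> configs. Q (Y \<eta>)} \<in> sets predictable_space"
    if "{x. Q x} \<in> sets borel" for Q
    using measurable_sets[OF Y that] by (intro rectangle_predictable) (simp add: vimage_def Int_def conj_commute)
  show "{w \<in> space predictable_space. a < (\<lambda>(t, \<eta>). if t \<in> {s<..u} then Y \<eta> else 0) w}
      \<in> sets predictable_space"
  proof (cases "a < 0")
    case False
    have "{w \<in> space predictable_space. a < (\<lambda>(t, \<eta>). if t \<in> {s<..u} then Y \<eta> else 0) w}
        = {s<..u} \<times> {\<eta> \<in> configs. a < Y \<eta>}"
      using False by (auto split: if_splits)
    then show ?thesis using strip[of "\<lambda>x. a < x"] by simp
  next
    case True
    have "{w \<in> space predictable_space. a < (\<lambda>(t, \<eta>). if t \<in> {s<..u} then Y \<eta> else 0) w}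
        = space predictable_space - {s<..u} \<times> {\<eta> \<in> configs. Y \<eta> \<le> a}"
      using True by (auto split: if_splits)
    then show ?thesis using strip[of "\<lambda>x. x \<le> a"] by (simp del: space_predictable)
  qed
qed

lemma time_measurable: "fst \<in> borel_measurable (predictable_space :: (real \<times> 'd config) measure)"
  unfolding borel_measurable_iff_greater
proof
  fix a :: real
  have "(\<Union>n::nat. {a<..a + real n} \<times> (configs :: 'd config set)) \<in> sets predictable_space"
    using sets.top[of "history a :: 'd config measure"]
    by (intro sets.countable_UN) (auto intro!: rectangle_predictable)
  also have "(\<Union>n::nat. {a<..a + real n} \<times> (configs :: 'd config set))
      = {w \<in> space predictable_space. a < fst w}"
  proof safe
    fix t and \<eta> :: "'d config"
    assume "(t, \<eta>) \<in> space predictable_space" "a < fst (t, \<eta>)"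
    moreover obtain n :: nat where "t - a < real n"
      using reals_Archimedean2 by blast
    ultimately show "(t, \<eta>) \<in> (\<Union>n::nat. {a<..a + real n} \<times> configs)"
      by (auto intro!: exI[of _ n])
  qed auto
  finally show "{w \<in> space (predictable_space :: (real \<times> 'd config) measure). a < fst w}
      \<in> sets predictable_space" .
qed

text \<open>
  The value at \<open>t\<close> is the limit of the values at the grid points \<open>(\<lceil>(n + 1) t\<rceil> - 1) / (n + 1)\<close>, which
  lie strictly below \<open>t\<close>. Each such approximation is constant in time on the half-open cells that
  generate the predictable sets.
\<close>

lemma left_continuous_adapted_predictable:
  fixes X :: "real \<Rightarrow> 'd config \<Rightarrow> real"
  assumes adapted: "\<And>t. X t \<in> borel_measurable (history t)"
    and left: "\<And>\<eta> t u. \<eta> \<in> configs \<Longrightarrow> u \<longlonglongrightarrow> t \<Longrightarrow> (\<And>n. u n < t) \<Longrightarrow> (\<lambda>n. X (u n) \<eta>) \<longlonglongrightarrow> X t \<eta>"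
  shows "(\<lambda>(t, \<eta>). X t \<eta>) \<in> borel_measurable predictable_space"
proof -
  define r where "r n k = (of_int k - 1) / real (Suc n)" for n and k :: int
  define cell where "cell n t = \<lceil>real (Suc n) * t\<rceil>" for n t
  have in_cell: "r n (cell n t) < t \<and> t \<le> r n (cell n t + 1)" for n t
    using ceiling_correct[of "real (Suc n) * t"]
    by (simp add: r_def cell_def pos_divide_less_eq pos_le_divide_eq mult.commute)
  have cell_measurable: "(\<lambda>w. cell n (fst w)) \<in> measurable predictable_space (count_space UNIV)" for n
    unfolding cell_def
    by (rule measurable_compose[OF _ measurable_real_ceiling]) (use time_measurable in measurable)
  have "(\<lambda>w. (\<lambda>(t, \<eta>). if t \<in> {r n (cell n (fst w))<..r n (cell n (fst w) + 1)}
          then X (r n (cell n (fst w))) \<eta> else 0) w)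
      \<in> borel_measurable predictable_space" for n
    by (rule measurable_compose_countable[where
          f = "\<lambda>k. \<lambda>(t, \<eta>). if t \<in> {r n k<..r n (k + 1)} then X (r n k) \<eta> else 0",
          OF predictable_strip[OF adapted] cell_measurable])
  then have approx: "(\<lambda>(t, \<eta>). X (r n (cell n t)) \<eta>) \<in> borel_measurable predictable_space" for n
    by (rule measurable_cong[THEN iffD1, rotated]) (use in_cell in auto)
  show ?thesis
  proof (rule borel_measurable_LIMSEQ_real[OF _ approx], clarify)
    fix t and \<eta> :: "'d config"
    assume "(t, \<eta>) \<in> space predictable_space"
    then have \<eta>: "\<eta> \<in> configs" by simp
    have "(\<lambda>n. r n (cell n t)) \<longlonglongrightarrow> t"
    proof (rule tendsto_sandwich[OF _ _ _ tendsto_const])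
      have "t - 1 / real (Suc n) \<le> r n (cell n t)" for n
        using in_cell[where n = n and t = t] by (simp add: r_def diff_divide_distrib)
      then show "\<forall>\<^sub>F n in sequentially. t - 1 / real (Suc n) \<le> r n (cell n t)" by simp
      show "\<forall>\<^sub>F n in sequentially. r n (cell n t) \<le> t"
        using in_cell by (simp add: less_imp_le)
      show "(\<lambda>n. t - 1 / real (Suc n)) \<longlonglongrightarrow> t"
        using tendsto_diff[OF tendsto_const[of t] LIMSEQ_Suc[OF lim_1_over_n]] by simp
    qed
    then show "(\<lambda>n. X (r n (cell n t)) \<eta>) \<longlonglongrightarrow> X t \<eta>"
      using in_cell by (intro left[OF \<eta>]) auto
  qed
qed

lemma predictable_slice:
  fixes F :: "real \<times> 'd config \<Rightarrow> 'b"
  assumes "F \<in> measurable predictable_space N"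
  shows "(\<lambda>\<eta>. F (t, \<eta>)) \<in> measurable config_space N"
proof -
  have "(\<lambda>\<eta> :: 'd config. (t, \<eta>)) \<in> measurable config_space predictable_space"
    unfolding predictable_space_def
  proof (rule measurable_measure_of[OF predictable_generators])
    fix R :: "(real \<times> 'd config) set"
    assume "R \<in> {{s<..u} \<times> E | s u E. E \<in> sets (history s)}"
    then obtain s u E where R: "R = {s<..u} \<times> E" and E: "E \<in> sets (history s)"
      by blast
    have "(\<lambda>\<eta>. (t, \<eta>)) -` R \<inter> space config_space = (if t \<in> {s<..u} then E else {})"
      using sets.sets_into_space[OF E] by (auto simp: R)
    then show "(\<lambda>\<eta>. (t, \<eta>)) -` R \<inter> space config_space \<in> sets config_space"
      using E sets_history_subset by auto
  qed auto
  from measurable_compose[OF this assms] show ?thesis .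
qed


section \<open>Intensities as predictable, shift-covariant processes\<close>

text \<open>
  The window is closed at its old end and open at the present, which makes the filtered process
  continuous from the left: a point enters just after its occurrence, and the finitely many points
  near the window fix it for all times shortly before \<open>t\<close>.
\<close>

lemma filtered_points_predictable:
  assumes A: "0 < A" and g: "continuous_on {0..A} g"
  shows "(\<lambda>(t, \<eta>). \<Sum>s\<in>\<eta> j \<inter> {t - A..<t}. g (t - s) :: real) \<in> borel_measurable predictable_space"
proof (rule left_continuous_adapted_predictable)
  fix t :: real
  have "(\<lambda>u. if u \<in> {0..A} then g u else 0) \<in> borel_measurable borel"
    using g by (intro borel_measurable_continuous_on_if) auto
  then have "(\<lambda>s. if t - s \<in> {0..A} then g (t - s) else 0) \<in> borel_measurable borel"
    by (rule measurable_compose[rotated]) simp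
  then have "(\<lambda>\<eta>. \<Sum>s\<in>\<eta> j \<inter> {t - A..<t}. if t - s \<in> {0..A} then g (t - s) else 0)
      \<in> borel_measurable (history t)"
    unfolding history_def by (rule point_sum_measurable) auto
  also have "(\<lambda>\<eta>. \<Sum>s\<in>\<eta> j \<inter> {t - A..<t}. if t - s \<in> {0..A} then g (t - s) else 0)
      = (\<lambda>\<eta>. \<Sum>s\<in>\<eta> j \<inter> {t - A..<t}. g (t - s))"
    by (auto intro!: sum.cong)
  finally show "(\<lambda>\<eta>. \<Sum>s\<in>\<eta> j \<inter> {t - A..<t}. g (t - s)) \<in> borel_measurable (history t)" .
next
  fix \<eta> :: "'a config" and t and u :: "nat \<Rightarrow> real"
  assume \<eta>: "\<eta> \<in> configs" and u: "u \<longlonglongrightarrow> t" "\<And>n. u n < t"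
  \<comment> \<open>One finite set of points serves the windows of all times in \<open>(t - 1, t]\<close>.\<close>
  define F where "F = \<eta> j \<inter> {t - A - 1..<t}"
  define w where "w r s = (if r - A \<le> s \<and> s < r then g (r - s) else 0)" for r s
  have finF: "finite F"
    unfolding F_def using \<eta> by (rule finite_points) simp
  have window: "(\<Sum>s\<in>\<eta> j \<inter> {r - A..<r}. g (r - s)) = (\<Sum>s\<in>F. w r s)"
    if "t - 1 < r" "r \<le> t" for r
    unfolding w_def using that
    by (intro sum.mono_neutral_cong_left finF) (auto simp: F_def)
  have "(\<lambda>n. w (u n) s) \<longlonglongrightarrow> w t s" if s: "s \<in> F" for s
  proof (cases "t - A \<le> s")
    case True
    from s have "s < t" by (simp add: F_def)
    then have ev: "\<forall>\<^sub>F n in sequentially. s < u n"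
      using order_tendstoD(1)[OF u(1)] by blast
    have inside: "u n - A \<le> s" for n
      using u(2)[of n] True by linarith
    have "(\<lambda>n. g (u n - s)) \<longlonglongrightarrow> g (t - s)"
    proof (rule continuous_on_tendsto_compose[OF g])
      show "(\<lambda>n. u n - s) \<longlonglongrightarrow> t - s"
        using u(1) by (intro tendsto_intros)
      show "t - s \<in> {0..A}"
        using True \<open>s < t\<close> by simp
      show "\<forall>\<^sub>F n in sequentially. u n - s \<in> {0..A}"
        using ev by eventually_elim (use inside in \<open>auto simp: algebra_simps\<close>)
    qed
    moreover have "\<forall>\<^sub>F n in sequentially. w (u n) s = g (u n - s)"
      using ev by eventually_elim (use inside in \<open>auto simp: w_def\<close>)
    ultimately show ?thesis
      using True \<open>s < t\<close> by (simp add: w_def tendsto_cong)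
  next
    case False
    have "\<forall>\<^sub>F n in sequentially. s + A < u n"
      using order_tendstoD(1)[OF u(1), of "s + A"] False by simp
    then have "\<forall>\<^sub>F n in sequentially. w (u n) s = 0"
      by eventually_elim (simp add: w_def)
    with False show ?thesis
      by (simp add: w_def tendsto_eventually)
  qed
  then have "(\<lambda>n. \<Sum>s\<in>F. w (u n) s) \<longlonglongrightarrow> (\<Sum>s\<in>F. w t s)"
    by (intro tendsto_sum)
  moreover have "\<forall>\<^sub>F n in sequentially. t - 1 < u n"
    using order_tendstoD(1)[OF u(1), of "t - 1"] by simp
  then have "\<forall>\<^sub>F n in sequentially.
      (\<Sum>s\<in>\<eta> j \<inter> {u n - A..<u n}. g (u n - s)) = (\<Sum>s\<in>F. w (u n) s)"
    by eventually_elim (rule window[OF _ less_imp_le[OF u(2)]])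
  ultimately show "(\<lambda>n. \<Sum>s\<in>\<eta> j \<inter> {u n - A..<u n}. g (u n - s))
      \<longlonglongrightarrow> (\<Sum>s\<in>\<eta> j \<inter> {t - A..<t}. g (t - s))"
    using window[of t] by (simp add: tendsto_cong)
qed

lemma shift_configs:
  assumes "\<eta> \<in> configs"
  shows "shift t \<eta> \<in> configs"
proof -
  have "finite ((\<lambda>s. s - t) ` \<eta> j \<inter> {a..b})" for j a b
  proof (rule finite_subset)
    show "(\<lambda>s. s - t) ` \<eta> j \<inter> {a..b} \<subseteq> (\<lambda>s. s - t) ` (\<eta> j \<inter> {a + t..b + t})"
      by auto
    show "finite ((\<lambda>s. s - t) ` (\<eta> j \<inter> {a + t..b + t}))"
      using assms by (simp add: configs_def)
  qed
  moreover have "(\<lambda>s. s - t) ` \<eta> i \<inter> (\<lambda>s. s - t) ` \<eta> j = {}" if "i \<noteq> j" for i j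
  proof -
    have "\<eta> i \<inter> \<eta> j = {}"
      using assms that by (simp add: configs_def)
    then show ?thesis
      by (subst image_Int[symmetric]) (simp_all add: inj_on_def)
  qed
  ultimately show ?thesis
    by (simp add: configs_def shift_def)
qed

lemma shift_window: "shift t \<eta> j \<inter> {0 - A..<0} = (\<lambda>s. s - t) ` (\<eta> j \<inter> {t - A..<t})"
  by (auto simp: shift_def)

lemma recent_shift: "recent A 0 (shift t \<eta>) = recent A t \<eta>"
  unfolding recent_def shift_window by (simp add: shift_def image_image)

lemma linpred_shift: "linpred M 0 \<theta> (shift t \<eta>) i = linpred M t \<theta> \<eta> i"
  unfolding linpred_def shift_window by (simp add: sum.reindex inj_on_def)

lemma intensity_shift: "intensity M 0 \<theta> (shift t \<eta>) = intensity M t \<theta> \<eta>"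
  by (simp add: intensity_def linpred_shift)

lemma intensity_deriv_shift: "intensity_deriv M 0 \<theta> (shift t \<eta>) = intensity_deriv M t \<theta> \<eta>"
  by (simp add: intensity_deriv_def intensity_shift)

lemma mat_op_inject: "mat_op X = mat_op Y \<longleftrightarrow> X = Y" for X Y :: "real ^ 'd ^ 'q"
proof
  have op: "blinfun_apply (mat_op Z) = (\<lambda>v. Z *v v)" for Z :: "real ^ 'd ^ 'q"
    unfolding mat_op_def by (rule bounded_linear_Blinfun_apply[OF matrix_vector_mul_bounded_linear])
  assume "mat_op X = mat_op Y"
  then have "(\<lambda>v. X *v v) = (\<lambda>v. Y *v v)"
    unfolding op[symmetric] by (rule arg_cong)
  then show "X = Y"
    unfolding matrix_eq by (auto dest: fun_cong)
qed simp

text \<open>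
  An admissible weight sees the configuration only through its recent past recentred at the current
  time, and that is unchanged when configuration and time are shifted together.
\<close>

lemma admissible_weight_shift:
  assumes "admissible_weight A K H" "\<theta> \<in> K" "\<eta> \<in> configs"
  shows "H t \<theta> \<eta> = H 0 \<theta> (shift t \<eta>)"
proof -
  have "\<exists>H0. \<forall>t. \<forall>\<eta>\<in>configs. mat_op (H t \<theta> \<eta>) = H0 \<theta> (recent A t \<eta>)"
    using assms(1)[unfolded admissible_weight_def] assms(2)
    by (elim conjE exE, rule_tac x = H0 in exI) simp
  then have "mat_op (H t \<theta> \<eta>) = mat_op (H 0 \<theta> (shift t \<eta>))"
    using assms(3) by (auto simp: shift_configs recent_shift)
  then show ?thesis by (simp add: mat_op_inject)
qed

text \<open>One sequence of steps, independent of \<open>f\<close>, is what measurability of a Jacobian entry requires.\<close>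

lemma jacobian_entry_limit:
  fixes f :: "real ^ 'p \<Rightarrow> real ^ 'd"
  assumes f: "f differentiable (at x)" and h: "h \<longlonglongrightarrow> 0" "\<And>n. h n \<noteq> 0"
  shows "(\<lambda>n. (f (x + h n *\<^sub>R axis a 1) $ i - f x $ i) / h n) \<longlonglongrightarrow> jacobian f (at x) $ i $ a"
proof -
  let ?D = "jacobian f (at x)"
  have "((\<lambda>r. x + r *\<^sub>R axis a 1) has_derivative (\<lambda>r. r *\<^sub>R axis a (1::real))) (at (0::real))"
    by (auto intro!: derivative_eq_intros)
  moreover have "(f has_derivative (\<lambda>v. ?D *v v)) (at (x + 0 *\<^sub>R axis a 1))"
    using f by (simp add: jacobian_works)
  ultimately have "((\<lambda>r. f (x + r *\<^sub>R axis a 1)) has_derivative (\<lambda>r. ?D *v (r *\<^sub>R axis a 1))) (at 0)"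
    by (rule has_derivative_compose)
  then have "((\<lambda>r. f (x + r *\<^sub>R axis a 1) $ i) has_derivative (\<lambda>r. (?D *v (r *\<^sub>R axis a 1)) $ i)) (at 0)"
    by (rule bounded_linear.has_derivative[OF bounded_linear_vec_nth])
  also have "(\<lambda>r. (?D *v (r *\<^sub>R axis a 1)) $ i) = (\<lambda>r. ?D $ i $ a * r)"
    by (simp add: matrix_vector_mult_scaleR matrix_vector_mul_component inner_axis mult.commute)
  finally have "DERIV (\<lambda>r. f (x + r *\<^sub>R axis a 1) $ i) 0 :> ?D $ i $ a"
    by (simp add: has_field_derivative_def)
  then have "((\<lambda>r. (f (x + r *\<^sub>R axis a 1) $ i - f x $ i) / r) \<longlongrightarrow> ?D $ i $ a) (at 0)"
    by (simp add: DERIV_def)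
  moreover have "filterlim h (at 0) sequentially"
    using h by (simp add: filterlim_at)
  ultimately show ?thesis
    by (rule filterlim_compose)
qed

lemma times_differentiable_onD:
  assumes "times_differentiable_on k f U" "0 < k" "x \<in> U"
  shows "f differentiable (at x)"
  using assms(1)[unfolded times_differentiable_on_def, THEN spec, of "[]"] assms(2,3) by simp

lemma C_k_onD:
  assumes "C_k_on k f U" "0 < k"
  shows "continuous_on U f" "\<And>x. x \<in> U \<Longrightarrow> f differentiable (at x)"
proof -
  show "continuous_on U f"
    using conjunct2[OF assms(1)[unfolded C_k_on_def], THEN spec, of "[]"] by simp
  show "f differentiable (at x)" if "x \<in> U" for x
    using times_differentiable_onD[OF conjunct1[OF assms(1)[unfolded C_k_on_def]]] assms(2) that .
qed

locale regular_hawkes =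
  fixes M :: "('d::finite, 'p::finite) hawkes"
    and Dom K \<Theta> \<Theta>0 :: "(real ^ 'p) set"
    and \<theta> :: "real ^ 'p"
  assumes memory: "0 < mem_len M"
    and cond_a: "condition_a M Dom K \<Theta> \<Theta>0"
    and cond_b: "condition_b M Dom K"
    and \<theta>0: "\<theta> \<in> \<Theta>0"
begin

lemma \<theta>_interior: "\<theta> \<in> interior K"
proof -
  have "\<Theta>0 \<subseteq> interior \<Theta>"
    using cond_a unfolding condition_a_def by (elim conjE)
  moreover have "\<Theta> \<subseteq> K"
    using cond_a unfolding condition_a_def by (elim conjE)
  ultimately show ?thesis
    using \<theta>0 interior_mono[of \<Theta> K] by blast
qed

lemma \<theta>_in_K: "\<theta> \<in> K"
  using \<theta>_interior interior_subset by blast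

lemma linpred_attainable: "\<theta>' \<in> K \<Longrightarrow> \<eta> \<in> configs \<Longrightarrow> linpred M t \<theta>' \<eta> i \<in> attainable M K i"
  unfolding attainable_def by blast

lemma link_domain:
  obtains U where "open U" "K \<times> attainable M K i \<subseteq> U"
    "continuous_on U (\<lambda>(\<theta>', x). link M \<theta>' i x)"
    "\<And>z. z \<in> U \<Longrightarrow> (\<lambda>(\<theta>', x). link M \<theta>' i x) differentiable (at z)"
proof -
  have "\<forall>i. \<exists>U. open U \<and> K \<times> attainable M K i \<subseteq> U \<and> U \<subseteq> Dom \<times> UNIV \<and>
      C_k_on 3 (\<lambda>(\<theta>', x). link M \<theta>' i x) U"
    using cond_a unfolding condition_a_def by (elim conjE)
  then obtain U where U: "open U" "K \<times> attainable M K i \<subseteq> U"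
    and C3: "C_k_on 3 (\<lambda>(\<theta>', x). link M \<theta>' i x) U"
    by blast
  show thesis
    by (rule that[OF U C_k_onD[OF C3]]) auto
qed

lemma intensity_pos:
  assumes "\<theta>' \<in> K" "\<eta> \<in> configs"
  shows "0 < intensity M t \<theta>' \<eta> $ i"
proof -
  have "\<exists>c>0. \<forall>i. \<forall>\<theta>\<in>K. \<forall>x\<in>attainable M K i. c \<le> link M \<theta> i x"
    using cond_a unfolding condition_a_def by (elim conjE)
  then obtain c where c: "0 < c" "\<forall>i. \<forall>\<theta>\<in>K. \<forall>x\<in>attainable M K i. c \<le> link M \<theta> i x"
    by blast
  have "c \<le> link M \<theta>' i (linpred M t \<theta>' \<eta> i)"
    using c(2) linpred_attainable[OF assms] assms(1) by blast
  with c(1) show ?thesis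
    by (simp add: intensity_def)
qed

lemma kern_continuous:
  assumes "\<theta>' \<in> K"
  shows "continuous_on {0..mem_len M} (kern M \<theta>' i j)"
proof -
  have "\<forall>i j. \<forall>bs. set bs \<subseteq> Basis \<and> length bs \<le> 3 \<longrightarrow>
      continuous_on ({0..mem_len M} \<times> K) (\<lambda>(u, \<theta>'). partials bs (\<lambda>\<theta>'. kern M \<theta>' i j u) \<theta>')"
    using cond_b unfolding condition_b_def by (elim conjE)
  from this[THEN spec[of _ i], THEN spec[of _ j], THEN spec[of _ "[]"]]
  have "continuous_on ({0..mem_len M} \<times> K) (\<lambda>(u, \<theta>'). kern M \<theta>' i j u)"
    by simp
  then have "continuous_on {0..mem_len M} ((\<lambda>(u, \<theta>'). kern M \<theta>' i j u) \<circ> (\<lambda>u. (u, \<theta>')))"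
    using assms by (intro continuous_on_compose) (auto intro!: continuous_intros elim: continuous_on_subset)
  then show ?thesis by (simp add: o_def)
qed

lemma linpred_predictable:
  assumes "\<theta>' \<in> K"
  shows "(\<lambda>(t, \<eta>). linpred M t \<theta>' \<eta> i) \<in> borel_measurable predictable_space"
proof -
  let ?A = "mem_len M"
  have "(\<lambda>w. \<Sum>s\<in>snd w j \<inter> {fst w - ?A..<fst w}. kern M \<theta>' i j (fst w - s))
      \<in> borel_measurable predictable_space" for j
    using filtered_points_predictable[OF memory kern_continuous[OF assms, of i j], of j]
    by (simp add: case_prod_beta')
  then have "(\<lambda>w. baseline M \<theta>' i +
        (\<Sum>j\<in>UNIV. \<Sum>s\<in>snd w j \<inter> {fst w - ?A..<fst w}. kern M \<theta>' i j (fst w - s)))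
      \<in> borel_measurable predictable_space"
    by simp
  also have "(\<lambda>w. baseline M \<theta>' i +
        (\<Sum>j\<in>UNIV. \<Sum>s\<in>snd w j \<inter> {fst w - ?A..<fst w}. kern M \<theta>' i j (fst w - s)))
      = (\<lambda>(t, \<eta>). linpred M t \<theta>' \<eta> i)"
    by (auto simp: linpred_def trunc_kern_def fun_eq_iff intro!: sum.cong)
  finally show ?thesis .
qed

lemma intensity_predictable:
  assumes "\<theta>' \<in> K"
  shows "(\<lambda>(t, \<eta>). intensity M t \<theta>' \<eta> $ i) \<in> borel_measurable predictable_space"
proof -
  obtain U where U: "open U" "K \<times> attainable M K i \<subseteq> U"
    "continuous_on U (\<lambda>(\<theta>', x). link M \<theta>' i x)"
    by (rule link_domain[of i])
  define S where "S = (\<lambda>x. (\<theta>', x)) -` U"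
  have pair: "continuous_on T (\<lambda>x. (\<theta>', x))" for T :: "real set"
    by (rule continuous_on_Pair[OF continuous_on_const continuous_on_id])
  have "open S"
    unfolding S_def by (rule open_vimage[OF U(1) pair])
  have "(\<lambda>x. (\<theta>', x)) ` S \<subseteq> U"
    by (auto simp: S_def)
  from continuous_on_compose2[OF U(3) pair this] have "continuous_on S (link M \<theta>' i)"
    by simp
  then have "(\<lambda>x. if x \<in> S then link M \<theta>' i x else 0) \<in> borel_measurable borel"
    using \<open>open S\<close> by (intro borel_measurable_continuous_on_if borel_open continuous_on_const)
  from measurable_compose[OF linpred_predictable[OF assms] this]
  have "(\<lambda>w. if (\<lambda>(t, \<eta>). linpred M t \<theta>' \<eta> i) w \<in> S
          then link M \<theta>' i ((\<lambda>(t, \<eta>). linpred M t \<theta>' \<eta> i) w) else 0)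
      \<in> borel_measurable predictable_space" .
  also have "?this \<longleftrightarrow> ?thesis"
  proof (rule measurable_cong)
    fix w :: "real \<times> 'd config" assume w: "w \<in> space predictable_space"
    obtain t \<eta> where w_eq: "w = (t, \<eta>)"
      by (cases w)
    have "(\<theta>', linpred M t \<theta>' \<eta> i) \<in> K \<times> attainable M K i"
      using w linpred_attainable[OF assms] assms by (simp add: w_eq)
    then have "linpred M t \<theta>' \<eta> i \<in> S"
      unfolding S_def using subsetD[OF U(2)] by simp
    then show "(if (\<lambda>(t, \<eta>). linpred M t \<theta>' \<eta> i) w \<in> S
          then link M \<theta>' i ((\<lambda>(t, \<eta>). linpred M t \<theta>' \<eta> i) w) else 0)
        = (\<lambda>(t, \<eta>). intensity M t \<theta>' \<eta> $ i) w"
      by (simp add: w_eq intensity_def)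
  qed
  finally show ?thesis .
qed

lemma linpred_differentiable: "(\<lambda>\<theta>'. linpred M t \<theta>' \<eta> i) differentiable (at \<theta>)"
proof -
  have baseline: "(\<lambda>\<theta>'. baseline M \<theta>' i) differentiable (at \<theta>)"
  proof -
    have "\<forall>i. \<exists>V. open V \<and> K \<subseteq> V \<and> V \<subseteq> Dom \<and> C_k_on 3 (\<lambda>\<theta>'. baseline M \<theta>' i) V"
      using cond_a unfolding condition_a_def by (elim conjE)
    then obtain V where "K \<subseteq> V" "C_k_on 3 (\<lambda>\<theta>'. baseline M \<theta>' i) V"
      by blast
    then show ?thesis
      using \<theta>_in_K by (intro C_k_onD(2)[of 3 _ V]) auto
  qed
  have kern: "(\<lambda>\<theta>'. kern M \<theta>' i j u) differentiable (at \<theta>)" if "u \<in> {0..mem_len M}" for j u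
  proof -
    have "\<forall>i j. \<exists>V. open V \<and> K \<subseteq> V \<and> V \<subseteq> Dom \<and>
        (\<forall>u\<in>{0..mem_len M}. times_differentiable_on 3 (\<lambda>\<theta>'. kern M \<theta>' i j u) V)"
      using cond_b unfolding condition_b_def by (elim conjE)
    then obtain V where V: "K \<subseteq> V"
      "\<forall>u\<in>{0..mem_len M}. times_differentiable_on 3 (\<lambda>\<theta>'. kern M \<theta>' i j u) V"
      by blast
    show ?thesis
      using times_differentiable_onD[OF bspec[OF V(2) that]] V(1) \<theta>_in_K by auto
  qed
  have "(\<lambda>\<theta>'. \<Sum>s\<in>\<eta> j \<inter> {t - mem_len M..<t}. trunc_kern M \<theta>' i j (t - s)) differentiable (at \<theta>)" for j
  proof (cases "finite (\<eta> j \<inter> {t - mem_len M..<t})")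
    case True
    have "(\<lambda>\<theta>'. trunc_kern M \<theta>' i j (t - s)) differentiable (at \<theta>)"
      if "s \<in> \<eta> j \<inter> {t - mem_len M..<t}" for s
      using that kern[of "t - s" j] by (auto simp: trunc_kern_def)
    with True show ?thesis by (intro differentiable_sum) auto
  qed simp
  then show ?thesis
    unfolding linpred_def by (intro differentiable_add baseline differentiable_sum) auto
qed

lemma intensity_differentiable:
  assumes "\<eta> \<in> configs"
  shows "(\<lambda>\<theta>'. intensity M t \<theta>' \<eta>) differentiable (at \<theta>)"
proof -
  have "(\<lambda>\<theta>'. link M \<theta>' i (linpred M t \<theta>' \<eta> i)) differentiable (at \<theta>)" for i
  proof -
    have "(\<theta>, linpred M t \<theta> \<eta> i) \<in> K \<times> attainable M K i"
      using linpred_attainable[OF \<theta>_in_K assms] \<theta>_in_K by simp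
    then have "(\<lambda>(\<theta>', x). link M \<theta>' i x) differentiable (at (\<theta>, linpred M t \<theta> \<eta> i))"
      by (metis link_domain[of i] subsetD)
    from differentiable_chain_at[OF differentiable_Pair[OF differentiable_ident linpred_differentiable] this]
    show ?thesis by (simp add: o_def)
  qed
  then have component: "(\<lambda>\<theta>'. intensity M t \<theta>' \<eta> $ i) differentiable (at \<theta>)" for i
    by (simp add: intensity_def)
  show ?thesis
  proof (rule differentiable_componentwise_within[THEN iffD2], rule ballI)
    fix b :: "real ^ 'd" assume "b \<in> Basis"
    then obtain i where "b = axis i 1"
      unfolding Basis_vec_def by auto
    then show "(\<lambda>\<theta>'. intensity M t \<theta>' \<eta> \<bullet> b) differentiable (at \<theta>)"
      using component[of i] by (simp add: inner_axis)
  qed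
qed

text \<open>
  Predictability is known for the intensities with parameter in \<open>K\<close> only. Since \<open>\<theta>\<close> is interior to
  \<open>K\<close>, the difference quotients can be taken with steps that stay in \<open>K\<close>.
\<close>

lemma intensity_deriv_predictable:
  "(\<lambda>(t, \<eta>). intensity_deriv M t \<theta> \<eta> $ i $ a) \<in> borel_measurable predictable_space"
proof -
  obtain e where e: "0 < e" "cball \<theta> e \<subseteq> K"
    using \<theta>_interior unfolding mem_interior_cball by blast
  \<comment> \<open>\<open>n + 1\<close> keeps the steps nonzero and at most \<open>e\<close>.\<close>
  define h where "h n = e / real (Suc n)" for n
  have h: "h \<longlonglongrightarrow> 0" "\<And>n. h n \<noteq> 0"
    unfolding h_def using e(1) LIMSEQ_Suc[OF lim_const_over_n[of e]] by simp_all
  have "\<theta> + h n *\<^sub>R axis a 1 \<in> K" for n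
  proof (rule subsetD[OF e(2)])
    have "h n \<le> e / 1"
      unfolding h_def using e(1) by (intro divide_left_mono) auto
    moreover have "0 \<le> h n"
      unfolding h_def using e(1) by simp
    ultimately have "\<bar>h n\<bar> \<le> e"
      by simp
    then show "\<theta> + h n *\<^sub>R axis a 1 \<in> cball \<theta> e"
      by (simp add: dist_norm norm_axis_1)
  qed
  then have quotient: "(\<lambda>w. ((\<lambda>(t, \<eta>). intensity M t (\<theta> + h n *\<^sub>R axis a 1) \<eta> $ i) w
      - (\<lambda>(t, \<eta>). intensity M t \<theta> \<eta> $ i) w) / h n) \<in> borel_measurable predictable_space" for n
    by (intro borel_measurable_divide borel_measurable_diff borel_measurable_const
        intensity_predictable \<theta>_in_K)
  show ?thesis
  proof (rule borel_measurable_LIMSEQ_real[OF _ quotient])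
    fix w :: "real \<times> 'd config" assume w: "w \<in> space predictable_space"
    obtain t \<eta> where w_eq: "w = (t, \<eta>)"
      by (cases w)
    have "(\<lambda>\<theta>'. intensity M t \<theta>' \<eta>) differentiable (at \<theta>)"
      using w by (intro intensity_differentiable) (simp add: w_eq)
    from jacobian_entry_limit[OF this h, of a i]
    show "(\<lambda>n. ((\<lambda>(t, \<eta>). intensity M t (\<theta> + h n *\<^sub>R axis a 1) \<eta> $ i) w
        - (\<lambda>(t, \<eta>). intensity M t \<theta> \<eta> $ i) w) / h n)
      \<longlonglongrightarrow> (\<lambda>(t, \<eta>). intensity_deriv M t \<theta> \<eta> $ i $ a) w"
      by (simp add: w_eq intensity_deriv_def)
  qed
qed

end


section \<open>Gram matrices of the weight rows and the score rows\<close>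

lemma vector_measurable:
  fixes f :: "'a \<Rightarrow> real ^ 'n"
  assumes "\<And>i. (\<lambda>x. f x $ i) \<in> borel_measurable N"
  shows "f \<in> borel_measurable N"
proof (rule borel_measurable_euclidean_space[THEN iffD2], rule ballI)
  fix b :: "real ^ 'n" assume "b \<in> Basis"
  then obtain i where "b = axis i 1"
    unfolding Basis_vec_def by auto
  then show "(\<lambda>x. f x \<bullet> b) \<in> borel_measurable N"
    using assms[of i] by (simp add: inner_axis)
qed

lemma measurable_vec_nth:
  fixes f :: "'a \<Rightarrow> 'b::euclidean_space ^ 'n"
  assumes "f \<in> borel_measurable N"
  shows "(\<lambda>x. f x $ i) \<in> borel_measurable N"
  by (rule measurable_compose[OF assms
        borel_measurable_continuous_onI[OF linear_continuous_on[OF bounded_linear_vec_nth]]])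

lemma integral_matrix_nth:
  fixes F :: "'a \<Rightarrow> real ^ 'n ^ 'm"
  assumes "integrable N F"
  shows "integrable N (\<lambda>x. F x $ i $ j)" "(\<integral>x. F x \<partial>N) $ i $ j = (\<integral>x. F x $ i $ j \<partial>N)"
proof -
  have entry: "bounded_linear (\<lambda>X :: real ^ 'n ^ 'm. X $ i $ j)"
    by (rule bounded_linear_compose[OF bounded_linear_vec_nth bounded_linear_vec_nth])
  show "integrable N (\<lambda>x. F x $ i $ j)"
    by (rule integrable_bounded_linear[OF entry assms])
  show "(\<integral>x. F x \<partial>N) $ i $ j = (\<integral>x. F x $ i $ j \<partial>N)"
    by (rule integral_bounded_linear[OF entry assms, symmetric])
qed

lemma integrable_matrix:
  fixes F :: "'a \<Rightarrow> real ^ 'n ^ 'm"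
  assumes "\<And>i j. integrable N (\<lambda>x. F x $ i $ j)"
  shows "integrable N F"
proof -
  have "F x = (\<Sum>i\<in>UNIV. \<Sum>j\<in>UNIV. F x $ i $ j *\<^sub>R axis i (axis j 1))" for x
  proof -
    have "(\<Sum>i\<in>UNIV. \<Sum>j\<in>UNIV. F x $ i $ j *\<^sub>R axis i (axis j (1::real))) $ k $ l
        = (\<Sum>i\<in>UNIV. if k = i then \<Sum>j\<in>UNIV. if l = j then F x $ i $ j else 0 else 0)" for k l
      unfolding sum_component by (intro sum.cong refl) (auto simp: axis_def mult_delta_right)
    also have "\<dots> k l = F x $ k $ l" for k l
      by simp
    finally show ?thesis
      by (simp add: vec_eq_iff)
  qed
  then have "F = (\<lambda>x. \<Sum>i\<in>UNIV. \<Sum>j\<in>UNIV. F x $ i $ j *\<^sub>R axis i (axis j 1))"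
    by (rule ext)
  moreover have "integrable N (\<lambda>x. \<Sum>i\<in>UNIV. \<Sum>j\<in>UNIV. F x $ i $ j *\<^sub>R axis i (axis j (1::real)))"
    by (intro Bochner_Integration.integrable_sum integrable_scaleR_left assms)
  ultimately show ?thesis by simp
qed

lemma diag_mat_nth: "(diag_mat v *v x) $ i = v $ i * x $ i"
  by (simp add: diag_mat_def matrix_vector_mult_def if_distrib[of "\<lambda>z. z * _"] cong: if_cong)

lemma matrix_inv_diag_mat:
  fixes v :: "real ^ 'n"
  assumes "\<And>i. v $ i \<noteq> 0"
  shows "matrix_inv (diag_mat v) = diag_mat (\<chi> i. inverse (v $ i))"
proof -
  let ?w = "\<chi> i. inverse (v $ i)"
  have 1: "diag_mat v ** diag_mat ?w = mat 1" "diag_mat ?w ** diag_mat v = mat 1"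
    using assms by (simp_all add: matrix_eq vec_eq_iff diag_mat_nth
        matrix_vector_mul_assoc[symmetric])
  then have "invertible (diag_mat v)"
    unfolding invertible_def by blast
  then have "matrix_inv (diag_mat v) = (matrix_inv (diag_mat v) ** diag_mat v) ** diag_mat ?w"
    using 1(1) by (simp add: matrix_mul_assoc[symmetric])
  also have "\<dots> = diag_mat ?w"
    by (simp add: matrix_inv_mult \<open>invertible (diag_mat v)\<close>)
  finally show ?thesis .
qed

lemma row_integrand_sum:
  "row_integrand M \<theta> f g \<eta> = (\<Sum>i\<in>UNIV. intensity M 0 \<theta> \<eta> $ i * (f 0 \<eta> $ i * g 0 \<eta> $ i))"
  by (simp add: row_integrand_def intensity_diag_def inner_vec_def diag_mat_nth mult.left_commute)

lemma row_integrand_commute: "row_integrand M \<theta> f g \<eta> = row_integrand M \<theta> g f \<eta>"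
  by (simp add: row_integrand_sum mult.commute)

lemma row_integrand_linear_combination:
  "row_integrand M \<theta> (\<lambda>t \<eta>. \<Sum>a\<in>UNIV. x $ a *\<^sub>R f a t \<eta>) (\<lambda>t \<eta>. \<Sum>b\<in>UNIV. y $ b *\<^sub>R g b t \<eta>) \<eta>
    = (\<Sum>a\<in>UNIV. \<Sum>b\<in>UNIV. x $ a * y $ b * row_integrand M \<theta> (f a) (g b) \<eta>)"
proof -
  have "intensity_diag M 0 \<theta> \<eta> *v (\<Sum>b\<in>UNIV. y $ b *\<^sub>R g b 0 \<eta>)
      = (\<Sum>b\<in>UNIV. y $ b *\<^sub>R (intensity_diag M 0 \<theta> \<eta> *v g b 0 \<eta>))"
    by (simp add: linear_sum[OF matrix_vector_mul_linear] matrix_vector_mult_scaleR)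
  then show ?thesis
    by (subst sum.swap)
      (simp add: row_integrand_def inner_sum_left inner_sum_right sum_distrib_left ac_simps)
qed

lemma row_integrand_diff:
  "row_integrand M \<theta> (\<lambda>t \<eta>. f t \<eta> - g t \<eta>) (\<lambda>t \<eta>. f t \<eta> - g t \<eta>) \<eta> =
    row_integrand M \<theta> f f \<eta> - 2 * row_integrand M \<theta> g f \<eta> + row_integrand M \<theta> g g \<eta>"
  using row_integrand_commute[of M \<theta> f g \<eta>]
  by (simp add: row_integrand_def inner_diff_left inner_diff_right matrix_vector_mult_diff_distrib)

lemma inner_matrix_sum:
  fixes X :: "real ^ 'n ^ 'm"
  shows "x \<bullet> (X *v y) = (\<Sum>a\<in>UNIV. \<Sum>b\<in>UNIV. x $ a * y $ b * X $ a $ b)"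
  by (simp add: inner_vec_def matrix_vector_mult_def sum_distrib_left ac_simps)

lemma integral_combination:
  fixes F :: "'m::finite \<Rightarrow> 'n::finite \<Rightarrow> 'a \<Rightarrow> real" and X :: "real ^ 'n ^ 'm"
  assumes "\<And>a b. integrable N (F a b)" "\<And>a b. (\<integral>\<eta>. F a b \<eta> \<partial>N) = X $ a $ b"
  shows "integrable N (\<lambda>\<eta>. \<Sum>a\<in>UNIV. \<Sum>b\<in>UNIV. x $ a * y $ b * F a b \<eta>)"
    and "(\<integral>\<eta>. (\<Sum>a\<in>UNIV. \<Sum>b\<in>UNIV. x $ a * y $ b * F a b \<eta>) \<partial>N) = x \<bullet> (X *v y)"
proof -
  have int: "integrable N (\<lambda>\<eta>. x $ a * y $ b * F a b \<eta>)" for a b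
    by (intro integrable_mult_right assms(1))
  show "integrable N (\<lambda>\<eta>. \<Sum>a\<in>UNIV. \<Sum>b\<in>UNIV. x $ a * y $ b * F a b \<eta>)"
    by (intro Bochner_Integration.integrable_sum int)
  have "(\<integral>\<eta>. (\<Sum>a\<in>UNIV. \<Sum>b\<in>UNIV. x $ a * y $ b * F a b \<eta>) \<partial>N)
      = (\<Sum>a\<in>UNIV. \<integral>\<eta>. (\<Sum>b\<in>UNIV. x $ a * y $ b * F a b \<eta>) \<partial>N)"
    by (intro Bochner_Integration.integral_sum Bochner_Integration.integrable_sum int)
  also have "\<dots> = (\<Sum>a\<in>UNIV. \<Sum>b\<in>UNIV. \<integral>\<eta>. x $ a * y $ b * F a b \<eta> \<partial>N)"
    by (intro sum.cong refl Bochner_Integration.integral_sum int)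
  also have "\<dots> = x \<bullet> (X *v y)"
    by (simp add: assms(2) inner_matrix_sum)
  finally show "(\<integral>\<eta>. (\<Sum>a\<in>UNIV. \<Sum>b\<in>UNIV. x $ a * y $ b * F a b \<eta>) \<partial>N) = x \<bullet> (X *v y)" .
qed

locale weighted_hawkes = regular_hawkes M Dom K \<Theta> \<Theta>0 \<theta>
  for M :: "('d::finite, 'p::finite) hawkes"
    and Dom K \<Theta> \<Theta>0 :: "(real ^ 'p) set"
    and \<theta> :: "real ^ 'p" +
  fixes P :: "real ^ 'p \<Rightarrow> 'd config measure"
    and H :: "('d, 'p, 'q::finite) weight"
  assumes law: "stationary_law M \<theta> (P \<theta>)"
    and fisher_integrable: "integrable (P \<theta>) (fisher_integrand M \<theta>)"
    and admissible: "admissible_weight (mem_len M) K H"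
    and \<Omega>_invertible: "invertible (Omega_mat M P H \<theta>)"
begin

abbreviation "score_row \<equiv> weight_row (score_weight M) \<theta>"
abbreviation "H_row \<equiv> weight_row H \<theta>"
abbreviation "\<Omega> \<equiv> Omega_mat M P H \<theta>"
abbreviation "A \<equiv> A_mat M P H \<theta>"
abbreviation "J \<equiv> J_mat M P H \<theta>"
abbreviation "I \<equiv> fisher M P \<theta>"
abbreviation "ip \<equiv> row_inner M P \<theta>"
abbreviation "integrand \<equiv> row_integrand M \<theta>"

lemma space_P: "space (P \<theta>) = configs"
  using law by (simp add: stationary_law_def)

lemma measurable_P: "measurable (P \<theta>) N = measurable config_space N"
  using law by (intro measurable_cong_sets) (simp_all add: stationary_law_def)

lemma intensity_neq_0: "\<eta> \<in> configs \<Longrightarrow> intensity M t \<theta> \<eta> $ i \<noteq> 0"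
  using intensity_pos[OF \<theta>_in_K, of \<eta> t i] by simp

lemma score_row_nth:
  assumes "\<eta> \<in> configs"
  shows "score_row a t \<eta> $ i = intensity_deriv M t \<theta> \<eta> $ i $ a / intensity M t \<theta> \<eta> $ i"
proof -
  have "matrix_inv (intensity_diag M t \<theta> \<eta>) = diag_mat (\<chi> i. inverse (intensity M t \<theta> \<eta> $ i))"
    unfolding intensity_diag_def by (rule matrix_inv_diag_mat) (rule intensity_neq_0[OF assms])
  then show ?thesis
    by (simp add: weight_row_def score_weight_def row_def matrix_matrix_mult_def transpose_def
        diag_mat_def if_distrib[of "\<lambda>z. _ * z"] divide_inverse cong: if_cong)
qed

lemma score_row_predictable:
  "(\<lambda>(t, \<eta>). score_row a t \<eta>) \<in> borel_measurable predictable_space"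
proof (rule vector_measurable)
  fix i
  have "(\<lambda>w. (\<lambda>(t, \<eta>). intensity_deriv M t \<theta> \<eta> $ i $ a) w / (\<lambda>(t, \<eta>). intensity M t \<theta> \<eta> $ i) w)
      \<in> borel_measurable predictable_space"
    by (intro borel_measurable_divide intensity_deriv_predictable intensity_predictable \<theta>_in_K)
  also have "?this \<longleftrightarrow>
      (\<lambda>w. (\<lambda>(t, \<eta>). score_row a t \<eta>) w $ i) \<in> borel_measurable predictable_space"
  proof (rule measurable_cong)
    fix w :: "real \<times> 'd config" assume w: "w \<in> space predictable_space"
    obtain t \<eta> where "w = (t, \<eta>)" by (cases w)
    with w show "(\<lambda>(t, \<eta>). intensity_deriv M t \<theta> \<eta> $ i $ a) w / (\<lambda>(t, \<eta>). intensity M t \<theta> \<eta> $ i) w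
        = (\<lambda>(t, \<eta>). score_row a t \<eta>) w $ i"
      by (simp add: score_row_nth)
  qed
  finally show "(\<lambda>w. (\<lambda>(t, \<eta>). score_row a t \<eta>) w $ i) \<in> borel_measurable predictable_space" .
qed

lemma H_row_predictable: "(\<lambda>(t, \<eta>). H_row k t \<eta>) \<in> borel_measurable predictable_space"
proof -
  have "\<forall>\<theta>\<in>K. (\<lambda>(t, \<eta>). H t \<theta> \<eta>) \<in> borel_measurable predictable_space"
    using admissible unfolding admissible_weight_def by (elim conjE)
  then have "(\<lambda>(t, \<eta>). H t \<theta> \<eta>) \<in> borel_measurable predictable_space"
    using \<theta>_in_K by blast
  then have "(\<lambda>w. (\<lambda>(t, \<eta>). H t \<theta> \<eta>) w $ k) \<in> borel_measurable predictable_space"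
    by (rule measurable_vec_nth)
  also have "(\<lambda>w. (\<lambda>(t, \<eta>). H t \<theta> \<eta>) w $ k) = (\<lambda>(t, \<eta>). H_row k t \<eta>)"
    by (simp add: fun_eq_iff weight_row_def row_def)
  finally show ?thesis .
qed

lemma row_integrand_measurable:
  assumes "(\<lambda>(t, \<eta>). f t \<eta>) \<in> borel_measurable predictable_space"
    "(\<lambda>(t, \<eta>). g t \<eta>) \<in> borel_measurable predictable_space"
  shows "integrand f g \<in> borel_measurable (P \<theta>)"
proof -
  have slice: "(\<lambda>\<eta>. r 0 \<eta> $ i) \<in> borel_measurable (P \<theta>)"
    if "(\<lambda>(t, \<eta>). r t \<eta>) \<in> borel_measurable predictable_space" for r :: "'d row_process" and i
    using measurable_vec_nth[OF predictable_slice[OF that, of 0], of i]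
    unfolding measurable_P by simp
  have int: "(\<lambda>\<eta>. intensity M 0 \<theta> \<eta> $ i) \<in> borel_measurable (P \<theta>)" for i
    using predictable_slice[OF intensity_predictable[OF \<theta>_in_K, of i], of 0]
    unfolding measurable_P by simp
  show ?thesis
    unfolding row_integrand_sum[abs_def]
    by (intro borel_measurable_sum borel_measurable_times int slice[OF assms(1)] slice[OF assms(2)])
qed

lemma row_integrand_nonneg: "\<eta> \<in> configs \<Longrightarrow> 0 \<le> integrand f f \<eta>"
  unfolding row_integrand_sum
  by (rule sum_nonneg, rule mult_nonneg_nonneg[OF less_imp_le[OF intensity_pos[OF \<theta>_in_K]] zero_le_square])

lemma row_inner_nonneg: "0 \<le> ip f f"
  unfolding row_inner_def
  by (rule integral_nonneg_AE, rule AE_I2) (simp add: space_P row_integrand_nonneg)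

text \<open>The pointwise bound \<open>2 \<bar>f \<Lambda> g\<^sup>T\<bar> \<le> f \<Lambda> f\<^sup>T + g \<Lambda> g\<^sup>T\<close> makes mixed products integrable.\<close>

lemma row_integrand_integrable:
  assumes f: "(\<lambda>(t, \<eta>). f t \<eta>) \<in> borel_measurable predictable_space" "integrable (P \<theta>) (integrand f f)"
    and g: "(\<lambda>(t, \<eta>). g t \<eta>) \<in> borel_measurable predictable_space" "integrable (P \<theta>) (integrand g g)"
  shows "integrable (P \<theta>) (integrand f g)"
proof (rule Bochner_Integration.integrable_bound)
  show "integrable (P \<theta>) (\<lambda>\<eta>. integrand f f \<eta> + integrand g g \<eta>)"
    by (intro Bochner_Integration.integrable_add f g)
  show "integrand f g \<in> borel_measurable (P \<theta>)"
    by (intro row_integrand_measurable f g)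
  show "AE \<eta> in P \<theta>. norm (integrand f g \<eta>) \<le> norm (integrand f f \<eta> + integrand g g \<eta>)"
  proof (rule AE_I2)
    fix \<eta> assume "\<eta> \<in> space (P \<theta>)"
    then have \<eta>: "\<eta> \<in> configs" by (simp add: space_P)
    have minus: "0 \<le> integrand f f \<eta> - 2 * integrand g f \<eta> + integrand g g \<eta>"
      using row_integrand_nonneg[OF \<eta>, of "\<lambda>t \<eta>. f t \<eta> - g t \<eta>"] unfolding row_integrand_diff .
    have neg: "integrand (\<lambda>t \<eta>. - g t \<eta>) f \<eta> = - integrand g f \<eta>"
        "integrand (\<lambda>t \<eta>. - g t \<eta>) (\<lambda>t \<eta>. - g t \<eta>) \<eta> = integrand g g \<eta>"
      by (simp_all add: row_integrand_sum sum_negf)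
    have plus: "0 \<le> integrand f f \<eta> + 2 * integrand g f \<eta> + integrand g g \<eta>"
      using row_integrand_nonneg[OF \<eta>, of "\<lambda>t \<eta>. f t \<eta> - (- g t \<eta>)"]
      unfolding row_integrand_diff[of M \<theta> f "\<lambda>t \<eta>. - g t \<eta>"] neg by simp
    show "norm (integrand f g \<eta>) \<le> norm (integrand f f \<eta> + integrand g g \<eta>)"
      using minus plus row_integrand_nonneg[OF \<eta>, of f] row_integrand_nonneg[OF \<eta>, of g]
        row_integrand_commute[of M \<theta> f g \<eta>]
      by (simp add: abs_le_iff)
  qed
qed

lemma fisher_gram:
  "integrable (P \<theta>) (integrand (score_row a) (score_row b))"
  "(\<integral>\<eta>. integrand (score_row a) (score_row b) \<eta> \<partial>P \<theta>) = I $ a $ b"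
proof -
  have eq: "fisher_integrand M \<theta> \<eta> $ a $ b = integrand (score_row a) (score_row b) \<eta>"
    if "\<eta> \<in> space (P \<theta>)" for \<eta>
  proof -
    have \<eta>: "\<eta> \<in> configs" using that by (simp add: space_P)
    show ?thesis
      by (simp add: \<eta> fisher_integrand_def row_integrand_sum score_row_nth outer_prod_def row_def)
        (intro sum.cong refl, simp add: intensity_neq_0[OF \<eta>] field_simps)
  qed
  have "integrable (P \<theta>) (\<lambda>\<eta>. fisher_integrand M \<theta> \<eta> $ a $ b)
      \<longleftrightarrow> integrable (P \<theta>) (integrand (score_row a) (score_row b))"
    by (rule Bochner_Integration.integrable_cong[OF refl]) (rule eq)
  then show "integrable (P \<theta>) (integrand (score_row a) (score_row b))"
    using integral_matrix_nth(1)[OF fisher_integrable, of a b] by blast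
  show "(\<integral>\<eta>. integrand (score_row a) (score_row b) \<eta> \<partial>P \<theta>) = I $ a $ b"
    unfolding fisher_def integral_matrix_nth(2)[OF fisher_integrable]
    by (rule sym, rule Bochner_Integration.integral_cong[OF refl eq])
qed

text \<open>
  Integrability of \<open>H \<Lambda> H\<^sup>T\<close> is forced by invertibility of \<open>\<Omega>\<close>: the integral of a non-integrable
  function is zero by convention, and the zero matrix is singular.
\<close>

lemma Omega_gram:
  "integrable (P \<theta>) (integrand (H_row k) (H_row l))"
  "(\<integral>\<eta>. integrand (H_row k) (H_row l) \<eta> \<partial>P \<theta>) = \<Omega> $ k $ l"
proof -
  let ?F = "\<lambda>\<eta>. H 0 \<theta> \<eta> ** intensity_diag M 0 \<theta> \<eta> ** transpose (H 0 \<theta> \<eta>)"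
  have "\<Omega> \<noteq> 0"
  proof
    assume "\<Omega> = 0"
    then have "(0 :: real ^ 'q ^ 'q) = mat 1"
      using matrix_inv_mult(1)[OF \<Omega>_invertible] by simp
    then have "(0 :: real ^ 'q ^ 'q) $ k $ k = mat 1 $ k $ k" by simp
    then show False by (simp add: mat_def)
  qed
  then have int: "integrable (P \<theta>) ?F"
    unfolding Omega_mat_def using not_integrable_integral_eq by blast
  have "?F \<eta> $ k $ l = integrand (H_row k) (H_row l) \<eta>" for \<eta>
    unfolding row_integrand_sum intensity_diag_def
    by (simp add: matrix_matrix_mult_def transpose_def diag_mat_def weight_row_def row_def
        if_distrib[of "\<lambda>z. _ * z"] ac_simps cong: if_cong)
  then show "integrable (P \<theta>) (integrand (H_row k) (H_row l))"
    "(\<integral>\<eta>. integrand (H_row k) (H_row l) \<eta> \<partial>P \<theta>) = \<Omega> $ k $ l"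
    unfolding Omega_mat_def using integral_matrix_nth[OF int, of k l] by simp_all
qed

text \<open>
  The division by the intensity in the score cancels the weight \<open>\<Lambda>\<close> of the inner product, which leaves
  \<open>H D\<close>.
\<close>

lemma A_gram:
  "integrable (P \<theta>) (integrand (H_row k) (score_row a))"
  "(\<integral>\<eta>. integrand (H_row k) (score_row a) \<eta> \<partial>P \<theta>) = A $ k $ a"
proof -
  let ?F = "\<lambda>\<eta>. H 0 \<theta> \<eta> ** intensity_deriv M 0 \<theta> \<eta>"
  have int: "integrable (P \<theta>) (integrand (H_row k) (score_row a))" for k a
    by (rule row_integrand_integrable[OF H_row_predictable Omega_gram(1)
          score_row_predictable fisher_gram(1)])
  have eq: "integrand (H_row k) (score_row a) \<eta> = ?F \<eta> $ k $ a"
    if "\<eta> \<in> space (P \<theta>)" for \<eta> k a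
  proof -
    have \<eta>: "\<eta> \<in> configs" using that by (simp add: space_P)
    have "H_row k 0 \<eta> $ i = H 0 \<theta> \<eta> $ k $ i" for i
      by (simp add: weight_row_def row_def)
    then show ?thesis
      by (simp add: row_integrand_sum score_row_nth[OF \<eta>] matrix_matrix_mult_def intensity_neq_0[OF \<eta>])
  qed
  have "integrable (P \<theta>) (integrand (H_row k) (score_row a))
      \<longleftrightarrow> integrable (P \<theta>) (\<lambda>\<eta>. ?F \<eta> $ k $ a)" for k a
    by (rule Bochner_Integration.integrable_cong[OF refl]) (rule eq)
  then have F: "integrable (P \<theta>) ?F"
    using int by (intro integrable_matrix) blast
  show "integrable (P \<theta>) (integrand (H_row k) (score_row a))"
    by (rule int)
  show "(\<integral>\<eta>. integrand (H_row k) (score_row a) \<eta> \<partial>P \<theta>) = A $ k $ a"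
    unfolding A_mat_def integral_matrix_nth(2)[OF F]
    by (rule Bochner_Integration.integral_cong[OF refl eq])
qed

lemma squared_distance:
  "ip (\<lambda>t \<eta>. (\<Sum>a\<in>UNIV. v $ a *\<^sub>R score_row a t \<eta>) - (\<Sum>k\<in>UNIV. c $ k *\<^sub>R H_row k t \<eta>))
         (\<lambda>t \<eta>. (\<Sum>a\<in>UNIV. v $ a *\<^sub>R score_row a t \<eta>) - (\<Sum>k\<in>UNIV. c $ k *\<^sub>R H_row k t \<eta>))
    = v \<bullet> (I *v v) - 2 * (c \<bullet> (A *v v)) + c \<bullet> (\<Omega> *v c)"
  unfolding row_inner_def row_integrand_diff row_integrand_linear_combination
  by (simp only: Bochner_Integration.integral_add Bochner_Integration.integral_diff
      Bochner_Integration.integrable_diff integrable_mult_right integral_mult_right_zero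
      integral_combination[OF fisher_gram] integral_combination[OF A_gram]
      integral_combination[OF Omega_gram])

lemma Omega_symmetric: "transpose \<Omega> = \<Omega>"
proof -
  have "\<Omega> $ k $ l = \<Omega> $ l $ k" for k l
    unfolding Omega_gram(2)[symmetric]
    by (rule Bochner_Integration.integral_cong[OF refl row_integrand_commute])
  then show ?thesis by (simp add: transpose_def vec_eq_iff)
qed

lemma fisher_symmetric: "transpose I = I"
proof -
  have "I $ a $ b = I $ b $ a" for a b
    unfolding fisher_gram(2)[symmetric]
    by (rule Bochner_Integration.integral_cong[OF refl row_integrand_commute])
  then show ?thesis by (simp add: transpose_def vec_eq_iff)
qed

lemma J_symmetric: "transpose J = J"
  unfolding J_mat_def by (rule transpose_schur[OF Omega_symmetric \<Omega>_invertible])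

lemma Omega_nonneg: "0 \<le> c \<bullet> (\<Omega> *v c)"
proof -
  have "0 \<le> 0 \<bullet> (I *v 0) - 2 * (c \<bullet> (A *v 0)) + c \<bullet> (\<Omega> *v c)"
    unfolding squared_distance[symmetric] by (rule row_inner_nonneg)
  then show ?thesis by simp
qed

lemma J_psd: "psd J"
proof -
  have "0 \<le> v \<bullet> (J *v v)" for v
  proof -
    let ?c = "matrix_inv \<Omega> *v (A *v v)"
    have "v \<bullet> (J *v v) = v \<bullet> (I *v v) - v \<bullet> ((I - J) *v v)"
      by (simp add: matrix_vector_mult_diff_rdistrib inner_diff_right)
    also have "\<dots> = ?c \<bullet> (\<Omega> *v ?c)"
      using complete_square[OF Omega_symmetric \<Omega>_invertible, of v I ?c A]
      by (simp add: J_mat_def matrix_inv_vector[OF \<Omega>_invertible])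
    finally show ?thesis
      using Omega_nonneg by simp
  qed
  with J_symmetric show ?thesis by (simp add: psd_def)
qed

text \<open>The Schur complement \<open>I - J\<close> is the Gram matrix of the projection residuals of the score rows.\<close>

lemma projection_residual:
  fixes v :: "real ^ 'p"
  defines "c \<equiv> matrix_inv \<Omega> *v (A *v v)"
  shows "ip
     (\<lambda>t \<eta>. (\<Sum>a\<in>UNIV. v $ a *\<^sub>R score_row a t \<eta>) - (\<Sum>k\<in>UNIV. c $ k *\<^sub>R H_row k t \<eta>))
     (\<lambda>t \<eta>. (\<Sum>a\<in>UNIV. v $ a *\<^sub>R score_row a t \<eta>) - (\<Sum>k\<in>UNIV. c $ k *\<^sub>R H_row k t \<eta>))
    = v \<bullet> ((I - J) *v v)"
  unfolding squared_distance J_mat_def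
  by (subst complete_square[OF Omega_symmetric \<Omega>_invertible]) (simp add: c_def)

lemma residual_le_distance:
  "v \<bullet> ((I - J) *v v) \<le> ip
     (\<lambda>t \<eta>. (\<Sum>a\<in>UNIV. v $ a *\<^sub>R score_row a t \<eta>) - (\<Sum>k\<in>UNIV. c $ k *\<^sub>R H_row k t \<eta>))
     (\<lambda>t \<eta>. (\<Sum>a\<in>UNIV. v $ a *\<^sub>R score_row a t \<eta>) - (\<Sum>k\<in>UNIV. c $ k *\<^sub>R H_row k t \<eta>))"
  unfolding squared_distance J_mat_def
  by (subst complete_square[OF Omega_symmetric \<Omega>_invertible]) (simp add: Omega_nonneg)

lemma information_bound: "psd (I - J)"
proof -
  have "transpose (I - J) = transpose I - transpose J"
    by (simp add: transpose_def vec_eq_iff)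
  moreover have "0 \<le> v \<bullet> ((I - J) *v v)" for v
    unfolding projection_residual[symmetric] by (rule row_inner_nonneg)
  ultimately show ?thesis
    unfolding psd_def by (simp add: J_symmetric fisher_symmetric)
qed

lemma score_row_in_row_space: "score_row a \<in> row_space M P \<theta>"
proof -
  have "score_row a t \<eta> = score_row a 0 (shift t \<eta>)" for t \<eta>
    by (simp add: weight_row_def score_weight_def intensity_deriv_shift intensity_diag_def
        intensity_shift)
  then show ?thesis
    unfolding row_space_def using score_row_predictable fisher_gram(1) by blast
qed

lemma H_combination_in_row_space: "(\<lambda>t \<eta>. \<Sum>k\<in>UNIV. c $ k *\<^sub>R H_row k t \<eta>) \<in> row_space M P \<theta>"
proof -
  have "(\<lambda>w. \<Sum>k\<in>UNIV. c $ k *\<^sub>R (\<lambda>(t, \<eta>). H_row k t \<eta>) w) \<in> borel_measurable predictable_space"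
    by (intro borel_measurable_sum borel_measurable_scaleR borel_measurable_const H_row_predictable)
  also have "(\<lambda>w. \<Sum>k\<in>UNIV. c $ k *\<^sub>R (\<lambda>(t, \<eta>). H_row k t \<eta>) w)
      = (\<lambda>(t, \<eta>). \<Sum>k\<in>UNIV. c $ k *\<^sub>R H_row k t \<eta>)"
    by (simp add: fun_eq_iff)
  finally have "(\<lambda>(t, \<eta>). \<Sum>k\<in>UNIV. c $ k *\<^sub>R H_row k t \<eta>) \<in> borel_measurable predictable_space" .
  moreover have "H_row k t \<eta> = H_row k 0 (shift t \<eta>)" if "\<eta> \<in> configs" for k t \<eta>
    unfolding weight_row_def using admissible_weight_shift[OF admissible \<theta>_in_K that, of t] by simp
  moreover have "integrable (P \<theta>) (integrand (\<lambda>t \<eta>. \<Sum>k\<in>UNIV. c $ k *\<^sub>R H_row k t \<eta>)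
      (\<lambda>t \<eta>. \<Sum>k\<in>UNIV. c $ k *\<^sub>R H_row k t \<eta>))"
    unfolding row_integrand_linear_combination[abs_def] by (rule integral_combination(1)[OF Omega_gram])
  ultimately show ?thesis
    unfolding row_space_def by simp
qed

text \<open>
  The residual bounds the distance to every linear combination from below and is attained by one of
  them. If it vanishes, one choice of coefficients is therefore within every tolerance.
\<close>

lemma score_row_in_closed_span_iff:
  "score_row a \<in> closed_row_span M P \<theta> H \<longleftrightarrow> (I - J) $ a $ a = 0"
proof -
  let ?e = "axis a 1 :: real ^ 'p"
  let ?dist = "\<lambda>c. row_norm M P \<theta> (\<lambda>t \<eta>. score_row a t \<eta> - (\<Sum>k\<in>UNIV. c $ k *\<^sub>R H_row k t \<eta>))"
  have e: "(\<Sum>b\<in>UNIV. ?e $ b *\<^sub>R score_row b t \<eta>) = score_row a t \<eta>" for t \<eta>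
    by (simp add: axis_def if_distrib[of "\<lambda>z. z *\<^sub>R _"] cong: if_cong)
  have diag: "?e \<bullet> ((I - J) *v ?e) = (I - J) $ a $ a"
    by (simp add: inner_axis' matrix_vector_mul_component inner_axis)
  show ?thesis
  proof
    assume mem: "score_row a \<in> closed_row_span M P \<theta> H"
    have "sqrt ((I - J) $ a $ a) < r" if r: "0 < r" for r
    proof -
      have "\<forall>r>0. \<exists>c :: 'q \<Rightarrow> real.
          (\<lambda>t \<eta>. \<Sum>k\<in>UNIV. c k *\<^sub>R H_row k t \<eta>) \<in> row_space M P \<theta> \<and>
          row_norm M P \<theta> (\<lambda>t \<eta>. score_row a t \<eta> - (\<Sum>k\<in>UNIV. c k *\<^sub>R H_row k t \<eta>)) < r"
        using mem unfolding closed_row_span_def mem_Collect_eq by (elim conjE)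
      then obtain c :: "'q \<Rightarrow> real" where
        "row_norm M P \<theta> (\<lambda>t \<eta>. score_row a t \<eta> - (\<Sum>k\<in>UNIV. c k *\<^sub>R H_row k t \<eta>)) < r"
        using r by blast
      then have "?dist (\<chi> k. c k) < r" by simp
      moreover have "sqrt ((I - J) $ a $ a) \<le> ?dist (\<chi> k. c k)"
        using residual_le_distance[of ?e "\<chi> k. c k"] unfolding e diag row_norm_def
        by (rule real_sqrt_le_mono)
      ultimately show ?thesis by linarith
    qed
    then have "sqrt ((I - J) $ a $ a) \<le> 0"
      by (meson not_le order_less_irrefl)
    moreover have "0 \<le> (I - J) $ a $ a"
      using information_bound unfolding psd_def diag[symmetric] by blast
    ultimately show "(I - J) $ a $ a = 0"
      by simp
  next
    assume zero: "(I - J) $ a $ a = 0"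
    define c where "c = matrix_inv \<Omega> *v (A *v ?e)"
    have "?dist c = 0"
      using projection_residual[of ?e] unfolding e diag zero c_def row_norm_def by simp
    then have "\<forall>r>0. \<exists>c :: 'q \<Rightarrow> real.
       (\<lambda>t \<eta>. \<Sum>k\<in>UNIV. c k *\<^sub>R H_row k t \<eta>) \<in> row_space M P \<theta> \<and>
       row_norm M P \<theta> (\<lambda>t \<eta>. score_row a t \<eta> - (\<Sum>k\<in>UNIV. c k *\<^sub>R H_row k t \<eta>)) < r"
      using H_combination_in_row_space[of c] by (intro allI impI exI[of _ "\<lambda>k. c $ k"]) simp
    then show "score_row a \<in> closed_row_span M P \<theta> H"
      unfolding closed_row_span_def using score_row_in_row_space by blast
  qed
qed

lemma equality_iff_score_in_closed_span:
  "J = I \<longleftrightarrow> (\<forall>a. score_row a \<in> closed_row_span M P \<theta> H)"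
proof
  assume "J = I"
  then show "\<forall>a. score_row a \<in> closed_row_span M P \<theta> H"
    unfolding score_row_in_closed_span_iff by simp
next
  assume "\<forall>a. score_row a \<in> closed_row_span M P \<theta> H"
  then have "I - J = 0"
    unfolding score_row_in_closed_span_iff by (intro psd_zero_diagonal information_bound) blast
  then show "J = I" by simp
qed

end

theorem proposition2p8:
  fixes M :: "('d::finite, 'p::finite) hawkes"
    and Dom K \<Theta> \<Theta>0 :: "(real ^ 'p) set"
    and lip :: "real ^ 'p \<Rightarrow> 'd \<Rightarrow> real"
    and P :: "real ^ 'p \<Rightarrow> 'd config measure"
    and H :: "('d, 'p, 'q::finite) weight"
    and \<theta> :: "real ^ 'p"
  assumes "CARD('p) \<le> CARD('q)"
    and "0 < mem_len M"
    and "condition_a M Dom K \<Theta> \<Theta>0"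
    and "condition_b M Dom K"
    and "condition_c M lip K \<Theta>"
    and "\<forall>\<theta>\<in>\<Theta>. stationary_law M \<theta> (P \<theta>)"
    and "condition_d M P \<Theta> \<Theta>0"
    and "\<theta> \<in> \<Theta>0"
    and "admissible_weight (mem_len M) K H"
    and "invertible (Omega_mat M P H \<theta>)"
  shows "loewner_le (J_mat M P H \<theta>) (fisher M P \<theta>) \<and>
    (invertible (J_mat M P H \<theta>) \<and> invertible (fisher M P \<theta>) \<longrightarrow>
      loewner_le (matrix_inv (fisher M P \<theta>)) (V_opt M P H \<theta>)) \<and>
    (J_mat M P H \<theta> = fisher M P \<theta> \<longleftrightarrow>
      (\<forall>k. weight_row (score_weight M) \<theta> k \<in> closed_row_span M P \<theta> H))"
proof -
  have "\<Theta>0 \<subseteq> interior \<Theta>"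
    using assms(3) unfolding condition_a_def by (elim conjE)
  then have "stationary_law M \<theta> (P \<theta>)"
    using assms(6,8) interior_subset[of \<Theta>] by blast
  moreover have "\<forall>\<theta>\<in>\<Theta>0. integrable (P \<theta>) (fisher_integrand M \<theta>)"
    using assms(7) unfolding condition_d_def by (elim conjE)
  ultimately interpret weighted_hawkes M Dom K \<Theta> \<Theta>0 \<theta> P H
    using assms by unfold_locales auto
  have le: "loewner_le J I"
    unfolding loewner_le_def by (rule information_bound)
  then show ?thesis
    using loewner_le_matrix_inv[OF J_psd _ fisher_symmetric] equality_iff_score_in_closed_span
    unfolding V_opt_def by simp
qed

end
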